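(* Let $A\in\mathcal{V}$ and $\theta\in Con(A)$. The following are equivalent: (1) $\theta$ has $CBLP$; (2) for all congruences $\phi,\psi$ of $A$ with $\phi\vee\psi=\nabla_A$ and $[\phi,\psi]\subseteq\theta$, there exists $\alpha\in B(Con(A))$ with $\alpha\subseteq\theta\vee\phi$ and $\neg\alpha\subseteq\theta\vee\psi$; (3) for all congruences $\phi,\psi$ of $A$ with $\phi\vee\psi=\nabla_A$ and $[\phi,\psi]=\theta$, there exists $\alpha\in B(Con(A))$ with $\alpha\subseteq\theta\vee\phi$ and $\neg\alpha\subseteq\theta\vee\psi$; (4) for every maximal congruence $\phi$ of $A$, $|B(Con(A/(\theta\vee\phi^{\diamond})))|\leq 2$.
   Context: $\mathcal{V}$ is a congruence modular, semidegenerate variety (no nontrivial algebra has a one-element subalgebra) of finite signature. For $B\in\mathcal{V}$: $Con(B)$ is its congruence lattice with bounds $\Delta_B,\nabla_B$, $[\cdot,\cdot]$ the Freese–McKenzie commutator, $K(B)$ the compact congruences. A congruence $\phi\neq\nabla_B$ is prime if $[\alpha,\beta]\subseteq\phi$ implies $\alpha\subseteq\phi$ or $\beta\subseteq\phi$; $\rho(\theta)$ is the intersection of primes containing $\theta$. $B(Con(B))$ is the Boolean algebra of complemented elements of $Con(B)$, with complement $\neg\alpha$. When $K(B)$ is closed under the commutator, the reticulation $L(B)=K(B)/{\equiv}$ ($\alpha\equiv\beta$ iff $\rho(\alpha)=\rho(\beta)$) is a bounded distributive lattice with canonical map $\lambda_B$, mapping $B(Con(B))$ injectively into $B(L(B))$;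 the reticulation preserves the Boolean center if this map is onto $B(L(B))$. Standing assumption: for every $B\in\mathcal{V}$, $K(B)$ is closed under the commutator and the reticulation of $B$ preserves the Boolean center. For $\phi\in Con(A)$, $\phi^{\diamond}=\bigvee\{\alpha\in B(Con(A)):\alpha\subseteq\phi\}$. A congruence $\theta$ of $A$ has $CBLP$ if for every $\beta\in B(Con(A/\theta))$ there is $\alpha\in B(Con(A))$ with $(\alpha\vee\theta)/\theta=\beta$. *)

theory Defs
  imports Main
begin

datatype ('f, 'v) trm = Var 'v | App 'f "('f, 'v) trm list"

record ('a, 'f) alg =
  univ :: "'a set"
  ops :: "'f \<Rightarrow> 'a list \<Rightarrow> 'a"

fun wf_trm :: "('f \<Rightarrow> nat) \<Rightarrow> ('f, 'v) trm \<Rightarrow> bool" where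
  "wf_trm ar (Var v) = True"
| "wf_trm ar (App f ts) = (length ts = ar f \<and> (\<forall>t\<in>set ts. wf_trm ar t))"

fun eval :: "('a, 'f, 'z) alg_scheme \<Rightarrow> ('v \<Rightarrow> 'a) \<Rightarrow> ('f, 'v) trm \<Rightarrow> 'a" where
  "eval A e (Var v) = e v"
| "eval A e (App f ts) = ops A f (map (eval A e) ts)"

definition is_alg :: "('f \<Rightarrow> nat) \<Rightarrow> ('a, 'f) alg \<Rightarrow> bool" where
  "is_alg ar A \<longleftrightarrow> univ A \<noteq> {} \<and>
     (\<forall>f xs. length xs = ar f \<and> set xs \<subseteq> univ A \<longrightarrow> ops A f xs \<in> univ A)"

definition in_var :: "('f \<Rightarrow> nat) \<Rightarrow> (('f, nat) trm \<times> ('f, nat) trm) set \<Rightarrow> ('a, 'f) alg \<Rightarrow> bool" where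
  "in_var ar Sig A \<longleftrightarrow> is_alg ar A \<and>
     (\<forall>(s, t)\<in>Sig. wf_trm ar s \<and> wf_trm ar t \<longrightarrow> (\<forall>e. range e \<subseteq> univ A \<longrightarrow> eval A e s = eval A e t))"

definition is_con :: "('f \<Rightarrow> nat) \<Rightarrow> ('a, 'f) alg \<Rightarrow> 'a rel \<Rightarrow> bool" where
  "is_con ar A \<theta> \<longleftrightarrow> equiv (univ A) \<theta> \<and>
     (\<forall>f xs ys. length xs = ar f \<and> list_all2 (\<lambda>x y. (x, y) \<in> \<theta>) xs ys
        \<longrightarrow> (ops A f xs, ops A f ys) \<in> \<theta>)"

definition Con :: "('f \<Rightarrow> nat) \<Rightarrow> ('a, 'f) alg \<Rightarrow> 'a rel set" where
  "Con ar A = {\<theta>. is_con ar A \<theta>}"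

definition Delta :: "('a, 'f) alg \<Rightarrow> 'a rel" where
  "Delta A = Id_on (univ A)"

definition Nabla :: "('a, 'f) alg \<Rightarrow> 'a rel" where
  "Nabla A = univ A \<times> univ A"

definition Cg :: "('f \<Rightarrow> nat) \<Rightarrow> ('a, 'f) alg \<Rightarrow> 'a rel \<Rightarrow> 'a rel" where
  "Cg ar A R = \<Inter>{\<theta> \<in> Con ar A. R \<subseteq> \<theta>}"

definition cjoin :: "('f \<Rightarrow> nat) \<Rightarrow> ('a, 'f) alg \<Rightarrow> 'a rel \<Rightarrow> 'a rel \<Rightarrow> 'a rel" where
  "cjoin ar A \<alpha> \<beta> = Cg ar A (\<alpha> \<union> \<beta>)"

definition cSup :: "('f \<Rightarrow> nat) \<Rightarrow> ('a, 'f) alg \<Rightarrow> 'a rel set \<Rightarrow> 'a rel" where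
  "cSup ar A S = Cg ar A (\<Union>S)"

definition Kc :: "('f \<Rightarrow> nat) \<Rightarrow> ('a, 'f) alg \<Rightarrow> 'a rel set" where
  "Kc ar A = {\<alpha> \<in> Con ar A. \<forall>S \<subseteq> Con ar A. \<alpha> \<subseteq> cSup ar A S \<longrightarrow>
      (\<exists>T \<subseteq> S. finite T \<and> \<alpha> \<subseteq> cSup ar A T)}"

section \<open>Freese--McKenzie commutator via the term condition\<close>

text \<open>C(alpha,beta;delta): terms with variables Inl i (the x-tuple) and Inr j (the y-tuple).\<close>
definition centralizes :: "('f \<Rightarrow> nat) \<Rightarrow> ('a, 'f) alg \<Rightarrow> 'a rel \<Rightarrow> 'a rel \<Rightarrow> 'a rel \<Rightarrow> bool" where
  "centralizes ar A \<alpha> \<beta> \<delta> \<longleftrightarrow>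
     (\<forall>(t :: ('f, nat + nat) trm) a b c d. wf_trm ar t \<and>
        (\<forall>i. (a i, b i) \<in> \<alpha>) \<and> (\<forall>j. (c j, d j) \<in> \<beta>) \<and>
        (eval A (case_sum a c) t, eval A (case_sum a d) t) \<in> \<delta>
        \<longrightarrow> (eval A (case_sum b c) t, eval A (case_sum b d) t) \<in> \<delta>)"

definition comm :: "('f \<Rightarrow> nat) \<Rightarrow> ('a, 'f) alg \<Rightarrow> 'a rel \<Rightarrow> 'a rel \<Rightarrow> 'a rel" where
  "comm ar A \<alpha> \<beta> = \<Inter>{\<delta> \<in> Con ar A. centralizes ar A \<alpha> \<beta> \<delta>}"

definition prime_con :: "('f \<Rightarrow> nat) \<Rightarrow> ('a, 'f) alg \<Rightarrow> 'a rel \<Rightarrow> bool" where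
  "prime_con ar A \<phi> \<longleftrightarrow> \<phi> \<in> Con ar A \<and> \<phi> \<noteq> Nabla A \<and>
     (\<forall>\<alpha>\<in>Con ar A. \<forall>\<beta>\<in>Con ar A. comm ar A \<alpha> \<beta> \<subseteq> \<phi> \<longrightarrow> \<alpha> \<subseteq> \<phi> \<or> \<beta> \<subseteq> \<phi>)"

text \<open>rho(theta); the empty intersection is Nabla.\<close>
definition rho :: "('f \<Rightarrow> nat) \<Rightarrow> ('a, 'f) alg \<Rightarrow> 'a rel \<Rightarrow> 'a rel" where
  "rho ar A \<theta> = Nabla A \<inter> \<Inter>{\<phi>. prime_con ar A \<phi> \<and> \<theta> \<subseteq> \<phi>}"

definition BCon :: "('f \<Rightarrow> nat) \<Rightarrow> ('a, 'f) alg \<Rightarrow> 'a rel set" where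
  "BCon ar A = {\<alpha> \<in> Con ar A. \<exists>\<beta> \<in> Con ar A.
      \<alpha> \<inter> \<beta> = Delta A \<and> cjoin ar A \<alpha> \<beta> = Nabla A}"

definition cneg :: "('f \<Rightarrow> nat) \<Rightarrow> ('a, 'f) alg \<Rightarrow> 'a rel \<Rightarrow> 'a rel" where
  "cneg ar A \<alpha> = (THE \<beta>. \<beta> \<in> Con ar A \<and> \<alpha> \<inter> \<beta> = Delta A \<and> cjoin ar A \<alpha> \<beta> = Nabla A)"

text \<open>Reticulation: L(A) = K(A)/\<equiv>, with canonical map lam.\<close>
definition lam :: "('f \<Rightarrow> nat) \<Rightarrow> ('a, 'f) alg \<Rightarrow> 'a rel \<Rightarrow> 'a rel set" where
  "lam ar A \<alpha> = {\<beta> \<in> Kc ar A. rho ar A \<beta> = rho ar A \<alpha>}"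

definition Ret :: "('f \<Rightarrow> nat) \<Rightarrow> ('a, 'f) alg \<Rightarrow> 'a rel set set" where
  "Ret ar A = lam ar A ` Kc ar A"

text \<open>Lattice operations of L(A): [a] v [b] = [a v b], [a] ^ [b] = [[a,b]], 0 = [Delta], 1 = [Nabla].
  The Boolean center B(L(A)) written out on representatives.\<close>
definition BRet :: "('f \<Rightarrow> nat) \<Rightarrow> ('a, 'f) alg \<Rightarrow> 'a rel set set" where
  "BRet ar A = {lam ar A \<alpha> | \<alpha>. \<alpha> \<in> Kc ar A \<and> (\<exists>\<gamma> \<in> Kc ar A.
      lam ar A (comm ar A \<alpha> \<gamma>) = lam ar A (Delta A) \<and>
      lam ar A (cjoin ar A \<alpha> \<gamma>) = lam ar A (Nabla A))}"

definition K_comm_closed :: "('f \<Rightarrow> nat) \<Rightarrow> ('a, 'f) alg \<Rightarrow> bool" where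
  "K_comm_closed ar A \<longleftrightarrow> (\<forall>\<alpha>\<in>Kc ar A. \<forall>\<beta>\<in>Kc ar A. comm ar A \<alpha> \<beta> \<in> Kc ar A)"

definition preserves_BC :: "('f \<Rightarrow> nat) \<Rightarrow> ('a, 'f) alg \<Rightarrow> bool" where
  "preserves_BC ar A \<longleftrightarrow> (\<forall>x \<in> BRet ar A. \<exists>\<alpha> \<in> BCon ar A. lam ar A \<alpha> = x)"

definition con_modular :: "('f \<Rightarrow> nat) \<Rightarrow> ('a, 'f) alg \<Rightarrow> bool" where
  "con_modular ar A \<longleftrightarrow> (\<forall>\<alpha>\<in>Con ar A. \<forall>\<beta>\<in>Con ar A. \<forall>\<gamma>\<in>Con ar A.
      \<alpha> \<subseteq> \<gamma> \<longrightarrow> cjoin ar A \<alpha> (\<beta> \<inter> \<gamma>) = cjoin ar A \<alpha> \<beta> \<inter> \<gamma>)"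

definition no_trivial_sub :: "('f \<Rightarrow> nat) \<Rightarrow> ('a, 'f) alg \<Rightarrow> bool" where
  "no_trivial_sub ar A \<longleftrightarrow> (\<exists>x y. x \<in> univ A \<and> y \<in> univ A \<and> x \<noteq> y) \<longrightarrow>
      \<not> (\<exists>x \<in> univ A. \<forall>f. ops A f (replicate (ar f) x) = x)"

definition var_hyp :: "('f \<Rightarrow> nat) \<Rightarrow> (('f, nat) trm \<times> ('f, nat) trm) set \<Rightarrow> ('b, 'f) alg \<Rightarrow> bool" where
  "var_hyp ar Sig B \<longleftrightarrow> (in_var ar Sig B \<longrightarrow>
      con_modular ar B \<and> no_trivial_sub ar B \<and> K_comm_closed ar B \<and> preserves_BC ar B)"

definition quot :: "('a, 'f) alg \<Rightarrow> 'a rel \<Rightarrow> ('a set, 'f) alg" where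
  "quot A \<theta> = \<lparr>univ = univ A // \<theta>,
     ops = (\<lambda>f Xs. \<theta> `` {ops A f (map (\<lambda>X. SOME x. x \<in> X) Xs)})\<rparr>"

definition quot_con :: "'a rel \<Rightarrow> 'a rel \<Rightarrow> 'a set rel" where
  "quot_con \<theta> \<alpha> = {(\<theta> `` {x}, \<theta> `` {y}) | x y. (x, y) \<in> \<alpha>}"

definition CBLP :: "('f \<Rightarrow> nat) \<Rightarrow> ('a, 'f) alg \<Rightarrow> 'a rel \<Rightarrow> bool" where
  "CBLP ar A \<theta> \<longleftrightarrow> (\<forall>\<beta> \<in> BCon ar (quot A \<theta>).
      \<exists>\<alpha> \<in> BCon ar A. quot_con \<theta> (cjoin ar A \<alpha> \<theta>) = \<beta>)"

definition maximal_con :: "('f \<Rightarrow> nat) \<Rightarrow> ('a, 'f) alg \<Rightarrow> 'a rel \<Rightarrow> bool" where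
  "maximal_con ar A \<phi> \<longleftrightarrow> \<phi> \<in> Con ar A \<and> \<phi> \<noteq> Nabla A \<and>
     (\<forall>\<psi> \<in> Con ar A. \<phi> \<subseteq> \<psi> \<longrightarrow> \<psi> = \<phi> \<or> \<psi> = Nabla A)"

definition diamond :: "('f \<Rightarrow> nat) \<Rightarrow> ('a, 'f) alg \<Rightarrow> 'a rel \<Rightarrow> 'a rel" where
  "diamond ar A \<phi> = cSup ar A {\<alpha> \<in> BCon ar A. \<alpha> \<subseteq> \<phi>}"

end

theory Submission
  imports Defs
begin

text \<open>
  Write \<open>\<Delta>\<close> for the congruence on the subalgebra \<open>\<beta> \<le> A\<^sup>2\<close> generated by the pairs
  \<open>((x,x),(y,y))\<close> with \<open>(x,y) \<in> \<alpha>\<close>. The term condition \<open>C(\<alpha>,\<beta>;\<delta>)\<close> says that \<open>\<delta> \<inter> \<beta>\<close> is a union of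
  \<open>\<Delta>\<close>-classes, and the shifting lemma in \<open>\<beta>\<close> (its congruence lattice is modular) makes this
  condition symmetric and upward closed in \<open>\<delta>\<close>. Hence the commutator is commutative and distributes
  over joins. As the diagonal collapses to a one-element subalgebra of \<open>\<gamma>/\<Delta>\<close> for \<open>\<alpha> = \<nabla>\<close>,
  semidegeneracy yields \<open>[\<gamma>,\<nabla>] = \<gamma>\<close>; the same idea with finitely many operations yields compactness
  of \<open>\<nabla>\<close>. Consequently \<open>\<phi> \<or> \<psi> = \<nabla>\<close> and \<open>[\<phi>,\<psi>] \<subseteq> \<theta>\<close> make \<open>\<theta> \<or> \<phi>\<close> and \<open>\<theta> \<or> \<psi>\<close> complementary above
  \<open>\<theta>\<close>, which gives the equivalence of (1), (2) and (3).

  For (2) to (4), compactness of the commutator of compact congruences reduces a decomposition over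
  \<open>\<theta> \<or> \<phi>\<^sup>\<diamond>\<close> to one over \<open>\<theta> \<or> \<alpha>\<close> with a single complemented \<open>\<alpha> \<subseteq> \<phi>\<close>. For (4) to (2), if no lift
  existed, the complemented congruences below \<open>\<theta> \<or> \<phi>\<close> or below \<open>\<theta> \<or> \<psi>\<close> would all lie in one
  maximal \<open>\<chi>\<close>; but over \<open>\<theta> \<or> \<chi>\<^sup>\<diamond>\<close> one of \<open>\<phi>, \<psi>\<close> becomes \<open>\<nabla>\<close>, so compactness puts the
  complement of some \<open>\<alpha> \<subseteq> \<chi>\<close> into that family.
\<close>

section \<open>Congruences, terms and quotients on representatives\<close>

lemma ConD:
  assumes "\<theta> \<in> Con ar A"
  shows "\<theta> \<subseteq> univ A \<times> univ A"
    and "\<And>x. x \<in> univ A \<Longrightarrow> (x, x) \<in> \<theta>"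
    and "\<And>x y. (x, y) \<in> \<theta> \<Longrightarrow> (y, x) \<in> \<theta>"
    and "\<And>x y z. (x, y) \<in> \<theta> \<Longrightarrow> (y, z) \<in> \<theta> \<Longrightarrow> (x, z) \<in> \<theta>"
    and "\<And>f xs ys. length xs = ar f \<Longrightarrow> list_all2 (\<lambda>x y. (x, y) \<in> \<theta>) xs ys
           \<Longrightarrow> (ops A f xs, ops A f ys) \<in> \<theta>"
  using assms unfolding Con_def is_con_def equiv_def refl_on_def sym_def trans_def by blast+

lemma ConI:
  assumes "\<theta> \<subseteq> univ A \<times> univ A"
    and "\<And>x. x \<in> univ A \<Longrightarrow> (x, x) \<in> \<theta>"
    and "\<And>x y. (x, y) \<in> \<theta> \<Longrightarrow> (y, x) \<in> \<theta>"
    and "\<And>x y z. (x, y) \<in> \<theta> \<Longrightarrow> (y, z) \<in> \<theta> \<Longrightarrow> (x, z) \<in> \<theta>"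
    and "\<And>f xs ys. length xs = ar f \<Longrightarrow> list_all2 (\<lambda>x y. (x, y) \<in> \<theta>) xs ys
           \<Longrightarrow> (ops A f xs, ops A f ys) \<in> \<theta>"
  shows "\<theta> \<in> Con ar A"
  using assms unfolding Con_def is_con_def equiv_def refl_on_def sym_def trans_def by blast

lemma Con_mem_univ:
  assumes "\<theta> \<in> Con ar A" "(x, y) \<in> \<theta>"
  shows "x \<in> univ A" "y \<in> univ A"
  using ConD(1)[OF assms(1)] assms(2) by auto

lemma Con_subset_Nabla: "\<theta> \<in> Con ar A \<Longrightarrow> \<theta> \<subseteq> Nabla A"
  unfolding Nabla_def by (rule ConD(1))

lemma Delta_subset_Con: "\<theta> \<in> Con ar A \<Longrightarrow> Delta A \<subseteq> \<theta>"
  unfolding Delta_def by (auto dest: ConD(2))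

lemma list_all2_fst_snd:
  "list_all2 (\<lambda>x y. (x, y) \<in> R) xs ys \<Longrightarrow> R \<subseteq> B \<times> C \<Longrightarrow> set xs \<subseteq> B \<and> set ys \<subseteq> C"
  by (induction rule: list_all2_induct) auto

lemma Nabla_Con: "is_alg ar A \<Longrightarrow> Nabla A \<in> Con ar A"
proof (rule ConI)
  fix f xs ys
  assume A: "is_alg ar A" and l: "length xs = ar f" "list_all2 (\<lambda>x y. (x, y) \<in> Nabla A) xs ys"
  then have "set xs \<subseteq> univ A \<and> set ys \<subseteq> univ A" "length ys = ar f"
    using list_all2_fst_snd[OF l(2)] by (auto simp: Nabla_def list_all2_lengthD)
  then show "(ops A f xs, ops A f ys) \<in> Nabla A"
    using A l unfolding is_alg_def Nabla_def by auto
qed (auto simp: Nabla_def)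

lemma Delta_Con: "is_alg ar A \<Longrightarrow> Delta A \<in> Con ar A"
proof (rule ConI)
  fix f xs ys
  assume A: "is_alg ar A" and l: "length xs = ar f" "list_all2 (\<lambda>x y. (x, y) \<in> Delta A) xs ys"
  have "set xs \<subseteq> univ A \<and> xs = ys"
    using l(2) by (induction rule: list_all2_induct) (auto simp: Delta_def)
  then show "(ops A f xs, ops A f ys) \<in> Delta A"
    using A l unfolding is_alg_def Delta_def by auto
qed (auto simp: Delta_def)

lemma Inter_Con:
  assumes "S \<subseteq> Con ar A" "S \<noteq> {}"
  shows "\<Inter>S \<in> Con ar A"
proof (rule ConI)
  obtain \<theta> where "\<theta> \<in> S" using assms(2) by blast
  then show "\<Inter>S \<subseteq> univ A \<times> univ A" using ConD(1)[of \<theta> ar A] assms(1) by blast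
next
  show "(x, x) \<in> \<Inter>S" if "x \<in> univ A" for x
    using that assms(1) ConD(2)[of _ ar A] by auto
  show "(y, x) \<in> \<Inter>S" if "(x, y) \<in> \<Inter>S" for x y
    using that assms(1) ConD(3)[of _ ar A x y] by auto
  show "(x, z) \<in> \<Inter>S" if "(x, y) \<in> \<Inter>S" "(y, z) \<in> \<Inter>S" for x y z
    using that assms(1) ConD(4)[of _ ar A x y z] by auto
next
  fix f xs ys
  assume l: "length xs = ar f" "list_all2 (\<lambda>x y. (x, y) \<in> \<Inter>S) xs ys"
  show "(ops A f xs, ops A f ys) \<in> \<Inter>S"
  proof
    fix \<theta> assume \<theta>: "\<theta> \<in> S"
    have "list_all2 (\<lambda>x y. (x, y) \<in> \<theta>) xs ys"
      using l(2) \<theta> by (auto elim!: list_all2_mono)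
    then show "(ops A f xs, ops A f ys) \<in> \<theta>" using ConD(5)[of \<theta> ar A] l(1) \<theta> assms(1) by blast
  qed
qed

lemma Int_Con: "\<alpha> \<in> Con ar A \<Longrightarrow> \<beta> \<in> Con ar A \<Longrightarrow> \<alpha> \<inter> \<beta> \<in> Con ar A"
  using Inter_Con[of "{\<alpha>, \<beta>}" ar A] by simp

lemma Cg_Con:
  assumes "is_alg ar A" "R \<subseteq> Nabla A"
  shows "Cg ar A R \<in> Con ar A"
  unfolding Cg_def using Nabla_Con[OF assms(1)] assms(2) by (intro Inter_Con) auto

lemma Cg_upper: "R \<subseteq> Cg ar A R"
  unfolding Cg_def by blast

lemma Cg_least: "\<theta> \<in> Con ar A \<Longrightarrow> R \<subseteq> \<theta> \<Longrightarrow> Cg ar A R \<subseteq> \<theta>"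
  unfolding Cg_def by blast

lemma Cg_mono: "R \<subseteq> S \<Longrightarrow> Cg ar A R \<subseteq> Cg ar A S"
  unfolding Cg_def by blast

lemma cjoin_upper: "\<alpha> \<subseteq> cjoin ar A \<alpha> \<beta>" "\<beta> \<subseteq> cjoin ar A \<alpha> \<beta>"
  unfolding cjoin_def using Cg_upper by fast+

lemma cjoin_least: "\<gamma> \<in> Con ar A \<Longrightarrow> \<alpha> \<subseteq> \<gamma> \<Longrightarrow> \<beta> \<subseteq> \<gamma> \<Longrightarrow> cjoin ar A \<alpha> \<beta> \<subseteq> \<gamma>"
  unfolding cjoin_def by (rule Cg_least) auto

lemma cjoin_commute: "cjoin ar A \<alpha> \<beta> = cjoin ar A \<beta> \<alpha>"
  unfolding cjoin_def by (simp add: Un_commute)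

lemma Union_subset_Nabla: "S \<subseteq> Con ar A \<Longrightarrow> \<Union>S \<subseteq> Nabla A"
  using Con_subset_Nabla by blast

lemma cjoin_Con: "is_alg ar A \<Longrightarrow> \<alpha> \<in> Con ar A \<Longrightarrow> \<beta> \<in> Con ar A \<Longrightarrow> cjoin ar A \<alpha> \<beta> \<in> Con ar A"
  unfolding cjoin_def by (rule Cg_Con) (auto dest: Con_subset_Nabla)

lemma cSup_Con: "is_alg ar A \<Longrightarrow> S \<subseteq> Con ar A \<Longrightarrow> cSup ar A S \<in> Con ar A"
  unfolding cSup_def by (rule Cg_Con) (auto dest: Union_subset_Nabla)

lemma cSup_upper: "\<alpha> \<in> S \<Longrightarrow> \<alpha> \<subseteq> cSup ar A S"
  unfolding cSup_def using Cg_upper by fast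

lemma cSup_least: "\<gamma> \<in> Con ar A \<Longrightarrow> (\<And>\<alpha>. \<alpha> \<in> S \<Longrightarrow> \<alpha> \<subseteq> \<gamma>) \<Longrightarrow> cSup ar A S \<subseteq> \<gamma>"
  unfolding cSup_def by (rule Cg_least) auto

text \<open>Arguments can be replaced one at a time and the steps composed by transitivity, so
  compatibility with basic translations is enough. This is the form in which
  \<open>syntactic_con\<close> delivers compatibility.\<close>

lemma ConI_unary:
  assumes alg: "is_alg ar A" and sub: "\<theta> \<subseteq> univ A \<times> univ A"
    and refl: "\<And>x. x \<in> univ A \<Longrightarrow> (x, x) \<in> \<theta>"
    and sym: "\<And>x y. (x, y) \<in> \<theta> \<Longrightarrow> (y, x) \<in> \<theta>"
    and trans: "\<And>x y z. (x, y) \<in> \<theta> \<Longrightarrow> (y, z) \<in> \<theta> \<Longrightarrow> (x, z) \<in> \<theta>"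
    and comp: "\<And>f us x y vs. Suc (length us + length vs) = ar f \<Longrightarrow> set us \<subseteq> univ A \<Longrightarrow>
       set vs \<subseteq> univ A \<Longrightarrow> (x, y) \<in> \<theta> \<Longrightarrow> (ops A f (us @ x # vs), ops A f (us @ y # vs)) \<in> \<theta>"
  shows "\<theta> \<in> Con ar A"
proof (rule ConI[OF sub refl sym trans])
  fix f xs ys
  have "list_all2 (\<lambda>x y. (x, y) \<in> \<theta>) xs ys \<Longrightarrow> length (us @ xs) = ar f \<Longrightarrow> set us \<subseteq> univ A \<Longrightarrow>
     (ops A f (us @ xs), ops A f (us @ ys)) \<in> \<theta>" for us
  proof (induction arbitrary: us rule: list_all2_induct)
    case Nil
    then show ?case using alg refl unfolding is_alg_def by simp
  next
    case (Cons x xs y ys)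
    have in_univ: "x \<in> univ A" "y \<in> univ A" "set xs \<subseteq> univ A"
      using Cons(1,2) sub list_all2_fst_snd[OF Cons(2) sub] by auto
    have "(ops A f (us @ x # xs), ops A f (us @ y # xs)) \<in> \<theta>"
      using Cons in_univ by (intro comp) auto
    moreover have "(ops A f ((us @ [y]) @ xs), ops A f ((us @ [y]) @ ys)) \<in> \<theta>"
      using Cons.prems in_univ by (intro Cons.IH) auto
    ultimately show ?case using trans by simp
  qed
  from this[of "[]"] show "length xs = ar f \<Longrightarrow> list_all2 (\<lambda>x y. (x, y) \<in> \<theta>) xs ys \<Longrightarrow>
     (ops A f xs, ops A f ys) \<in> \<theta>" by simp
qed

section \<open>Evaluation and substitution of terms\<close>

lemma eval_in_univ:
  assumes "is_alg ar A" "range e \<subseteq> univ A"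
  shows "wf_trm ar t \<Longrightarrow> eval A e t \<in> univ A"
proof (induction t)
  case (Var v)
  then show ?case using assms(2) by auto
next
  case (App f ts)
  then have "set (map (eval A e) ts) \<subseteq> univ A" "length (map (eval A e) ts) = ar f" by auto
  then show ?case using assms(1) unfolding is_alg_def by simp
qed

lemma eval_Con:
  assumes "\<theta> \<in> Con ar A" "\<And>v. (e v, e' v) \<in> \<theta>"
  shows "wf_trm ar t \<Longrightarrow> (eval A e t, eval A e' t) \<in> \<theta>"
proof (induction t)
  case (Var v)
  then show ?case using assms(2) by auto
next
  case (App f ts)
  then have "list_all2 (\<lambda>x y. (x, y) \<in> \<theta>) (map (eval A e) ts) (map (eval A e') ts)"
    by (auto simp: list_all2_conv_all_nth)
  then show ?case using ConD(5)[OF assms(1)] App by simp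
qed

fun subst :: "('v \<Rightarrow> ('f, 'w) trm) \<Rightarrow> ('f, 'v) trm \<Rightarrow> ('f, 'w) trm" where
  "subst s (Var v) = s v"
| "subst s (App f ts) = App f (map (subst s) ts)"

lemma eval_subst: "eval A e (subst s t) = eval A (\<lambda>v. eval A e (s v)) t"
  by (induction t) (auto simp: comp_def cong: map_cong)

lemma wf_subst: "wf_trm ar t \<Longrightarrow> (\<And>v. wf_trm ar (s v)) \<Longrightarrow> wf_trm ar (subst s t)"
  by (induction t) auto

section \<open>Quotients on representatives\<close>

definition rep :: "'a rel \<Rightarrow> 'a \<Rightarrow> 'a" where
  "rep \<theta> x = (SOME y. (x, y) \<in> \<theta>)"

text \<open>The quotient carried by a system of representatives: unlike \<^const>\<open>quot\<close>, it has the same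
  element type as the algebra itself.\<close>
definition rep_quot :: "('a, 'f) alg \<Rightarrow> 'a rel \<Rightarrow> ('a, 'f) alg" where
  "rep_quot A \<theta> = \<lparr>univ = rep \<theta> ` univ A, ops = (\<lambda>f xs. rep \<theta> (ops A f xs))\<rparr>"

lemma rep_quot_simps:
  "univ (rep_quot A \<theta>) = rep \<theta> ` univ A"
  "ops (rep_quot A \<theta>) f xs = rep \<theta> (ops A f xs)"
  unfolding rep_quot_def by simp_all

lemma rep_Con:
  assumes "\<theta> \<in> Con ar A" "x \<in> univ A"
  shows "(x, rep \<theta> x) \<in> \<theta>"
  unfolding rep_def using ConD(2)[OF assms] by (rule someI)

text \<open>\<theta>-related elements define the same predicate for \<open>SOME\<close>, so
  \<open>rep\<close> picks one element per class.\<close>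

lemma rep_eq_iff:
  assumes \<theta>: "\<theta> \<in> Con ar A" and "x \<in> univ A" "y \<in> univ A"
  shows "rep \<theta> x = rep \<theta> y \<longleftrightarrow> (x, y) \<in> \<theta>"
proof
  assume "(x, y) \<in> \<theta>"
  then have "(x, z) \<in> \<theta> \<longleftrightarrow> (y, z) \<in> \<theta>" for z using ConD(3,4)[OF \<theta>] by blast
  then show "rep \<theta> x = rep \<theta> y" unfolding rep_def by simp
next
  assume "rep \<theta> x = rep \<theta> y"
  then show "(x, y) \<in> \<theta>" using rep_Con[OF \<theta>] assms(2,3) ConD(3,4)[OF \<theta>] by metis
qed

lemma rep_quot_in_var:
  fixes A :: "('a, 'f) alg"
  assumes A: "in_var ar Sig A" and \<theta>: "\<theta> \<in> Con ar A"
  shows "in_var ar Sig (rep_quot A \<theta>)"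
proof -
  have alg: "is_alg ar A" using A unfolding in_var_def by simp
  have sub: "univ (rep_quot A \<theta>) \<subseteq> univ A"
    unfolding rep_quot_simps using rep_Con[OF \<theta>] Con_mem_univ(2)[OF \<theta>] by fastforce
  have "is_alg ar (rep_quot A \<theta>)"
    using alg sub unfolding is_alg_def by (auto simp: rep_quot_simps)
  \<comment> \<open>Representatives are elements of \<open>A\<close> and fixed by
    \<open>rep\<close>, so a term can be evaluated in \<open>A\<close> and projected once at the
    end; identities of \<open>A\<close> then carry over.\<close>
  moreover have ev: "eval (rep_quot A \<theta>) e t = rep \<theta> (eval A e t)"
    if e: "range e \<subseteq> univ (rep_quot A \<theta>)" and "wf_trm ar t" for e :: "nat \<Rightarrow> 'a" and t
    using that(2)
  proof (induction t)
    case (Var v)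
    have "e v \<in> rep \<theta> ` univ A" using e by (auto simp: rep_quot_simps)
    then obtain x where x: "x \<in> univ A" "e v = rep \<theta> x" by auto
    have "rep \<theta> x \<in> univ A" using rep_Con[OF \<theta>] Con_mem_univ[OF \<theta>] x by blast
    then have "rep \<theta> (rep \<theta> x) = rep \<theta> x"
      using x rep_Con[OF \<theta>] rep_eq_iff[OF \<theta>] by metis
    then show ?case using x by simp
  next
    case (App f ts)
    have e': "range e \<subseteq> univ A" using e sub by simp
    have in_univ: "eval A e t \<in> univ A" if "t \<in> set ts" for t
      using that App eval_in_univ[OF alg e'] by auto
    then have "list_all2 (\<lambda>x y. (x, y) \<in> \<theta>) (map (eval A e) ts) (map (\<lambda>t. rep \<theta> (eval A e t)) ts)"
      using rep_Con[OF \<theta>] by (auto simp: list_all2_conv_all_nth)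
    then have "(ops A f (map (eval A e) ts), ops A f (map (\<lambda>t. rep \<theta> (eval A e t)) ts)) \<in> \<theta>"
      using ConD(5)[OF \<theta>] App by simp
    then have "rep \<theta> (ops A f (map (eval A e) ts)) = rep \<theta> (ops A f (map (\<lambda>t. rep \<theta> (eval A e t)) ts))"
      using rep_eq_iff[OF \<theta>] Con_mem_univ[OF \<theta>] by metis
    moreover have "map (eval (rep_quot A \<theta>) e) ts = map (\<lambda>t. rep \<theta> (eval A e t)) ts"
      using App by auto
    ultimately show ?case by (simp only: eval.simps rep_quot_simps)
  qed
  ultimately show ?thesis
    using A sub unfolding in_var_def by (auto split: prod.splits)
qed

text \<open>The class of \<open>x\<close> is a one-element subalgebra of the quotient by \<theta>,
  so semidegeneracy makes that quotient trivial. As \<open>rep_quot\<close> keeps the element type,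
  the hypothesis at type \<open>'b\<close> covers the quotient as well.\<close>

lemma quotient_idempotent_trivial:
  assumes V: "\<forall>B :: ('b, 'f) alg. var_hyp ar Sig B"
    and A: "in_var ar Sig (A :: ('b, 'f) alg)" and \<theta>: "\<theta> \<in> Con ar A"
    and x: "x \<in> univ A" "\<And>f. (x, ops A f (replicate (ar f) x)) \<in> \<theta>"
  shows "\<theta> = Nabla A"
proof -
  let ?Q = "rep_quot A \<theta>"
  have "no_trivial_sub ar ?Q"
    using V rep_quot_in_var[OF A \<theta>] unfolding var_hyp_def by blast
  moreover have "ops ?Q f (replicate (ar f) (rep \<theta> x)) = rep \<theta> x" for f
  proof -
    have "(ops A f (replicate (ar f) x), ops A f (replicate (ar f) (rep \<theta> x))) \<in> \<theta>"
      using rep_Con[OF \<theta> x(1)] by (intro ConD(5)[OF \<theta>]) (auto simp: list_all2_conv_all_nth)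
    then have "(x, ops A f (replicate (ar f) (rep \<theta> x))) \<in> \<theta>"
      using x(2) ConD(4)[OF \<theta>] by blast
    then show ?thesis
      using rep_eq_iff[OF \<theta>] Con_mem_univ[OF \<theta>] by (metis rep_quot_simps(2))
  qed
  ultimately have "y = z" if "y \<in> univ ?Q" "z \<in> univ ?Q" for y z
    using x(1) that unfolding no_trivial_sub_def by (auto simp: rep_quot_simps)
  then have "rep \<theta> y = rep \<theta> z" if "y \<in> univ A" "z \<in> univ A" for y z
    using that by (simp add: rep_quot_simps)
  then show ?thesis
    using rep_eq_iff[OF \<theta>] ConD(1)[OF \<theta>] unfolding Nabla_def by auto
qed

section \<open>Congruences as subalgebras of the square\<close>

definition pairalg :: "('a, 'f) alg \<Rightarrow> 'a rel \<Rightarrow> ('a \<times> 'a, 'f) alg" where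
  "pairalg A \<beta> = \<lparr>univ = \<beta>, ops = (\<lambda>f xs. (ops A f (map fst xs), ops A f (map snd xs)))\<rparr>"

lemma pairalg_simps [simp]:
  "univ (pairalg A \<beta>) = \<beta>"
  "ops (pairalg A \<beta>) f xs = (ops A f (map fst xs), ops A f (map snd xs))"
  unfolding pairalg_def by simp_all

lemma eval_pairalg: "eval (pairalg A \<beta>) e t = (eval A (fst \<circ> e) t, eval A (snd \<circ> e) t)"
  by (induction t) (auto simp: comp_def cong: map_cong)

lemma pairalg_alg:
  assumes "is_alg ar A" "\<beta> \<in> Con ar A"
  shows "is_alg ar (pairalg A \<beta>)"
proof -
  obtain x where "x \<in> univ A" using assms(1) unfolding is_alg_def by blast
  then have "\<beta> \<noteq> {}" using ConD(2)[OF assms(2)] by blast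
  moreover have "(ops A f (map fst xs), ops A f (map snd xs)) \<in> \<beta>"
    if "length xs = ar f" "set xs \<subseteq> \<beta>" for f xs
    using that by (intro ConD(5)[OF assms(2)]) (auto simp: list_all2_conv_all_nth)
  ultimately show ?thesis unfolding is_alg_def by auto
qed

lemma pairalg_in_var:
  fixes A :: "('a, 'f) alg"
  assumes A: "in_var ar Sig A" and \<beta>: "\<beta> \<in> Con ar A"
  shows "in_var ar Sig (pairalg A \<beta>)"
proof -
  have "range (fst \<circ> e) \<subseteq> univ A" "range (snd \<circ> e) \<subseteq> univ A" if "range e \<subseteq> \<beta>" for e :: "nat \<Rightarrow> 'a \<times> 'a"
    using that ConD(1)[OF \<beta>] by (auto simp: image_subset_iff) (metis mem_Sigma_iff prod.collapse subsetD)+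
  then show ?thesis
    using A pairalg_alg[OF _ \<beta>] unfolding in_var_def by (auto simp: eval_pairalg)
qed

section \<open>The term condition and the shifting lemma\<close>

text \<open>Freese and McKenzie's congruence \<Delta>. A related pair
  \<open>((p, r), (q, s))\<close> is a 2 by 2 matrix whose rows lie in \<beta> and whose first
  column lies in \<alpha>.\<close>

definition diag_con :: "('f \<Rightarrow> nat) \<Rightarrow> ('a, 'f) alg \<Rightarrow> 'a rel \<Rightarrow> 'a rel \<Rightarrow> ('a \<times> 'a) rel" where
  "diag_con ar A \<beta> \<alpha> = Cg ar (pairalg A \<beta>) {((x, x), (y, y)) | x y. (x, y) \<in> \<alpha>}"

lemma diag_con_gens:
  assumes "\<alpha> \<in> Con ar A" "\<beta> \<in> Con ar A"
  shows "{((x, x), (y, y)) | x y. (x, y) \<in> \<alpha>} \<subseteq> Nabla (pairalg A \<beta>)"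
  unfolding Nabla_def using Con_mem_univ[OF assms(1)] ConD(2)[OF assms(2)] by auto

lemma diag_con_Con:
  assumes "is_alg ar A" "\<alpha> \<in> Con ar A" "\<beta> \<in> Con ar A"
  shows "diag_con ar A \<beta> \<alpha> \<in> Con ar (pairalg A \<beta>)"
  unfolding diag_con_def using assms by (intro Cg_Con pairalg_alg diag_con_gens[of _ ar])

lemma diag_con_gen: "(x, y) \<in> \<alpha> \<Longrightarrow> ((x, x), (y, y)) \<in> diag_con ar A \<beta> \<alpha>"
  unfolding diag_con_def using Cg_upper by fast

lemma diag_con_mono: "\<alpha> \<subseteq> \<alpha>' \<Longrightarrow> diag_con ar A \<beta> \<alpha> \<subseteq> diag_con ar A \<beta> \<alpha>'"
  unfolding diag_con_def by (rule Cg_mono) blast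

section \<open>Saturation and syntactic congruences\<close>

definition saturates :: "'a rel \<Rightarrow> 'a set \<Rightarrow> bool" where
  "saturates E S \<longleftrightarrow> (\<forall>x y. (x, y) \<in> E \<and> x \<in> S \<longrightarrow> y \<in> S)"

text \<open>The analogue of the syntactic congruence of a language: the largest congruence on whose
  classes membership in \<open>S\<close> is constant. The moved element enters through the
  \<open>Inl\<close> variables and the parameters through \<open>Inr\<close>, so that the terms are
  those of \<open>centralizes\<close>.\<close>

definition syntactic_con :: "('f \<Rightarrow> nat) \<Rightarrow> ('a, 'f) alg \<Rightarrow> 'a set \<Rightarrow> 'a rel" where
  "syntactic_con ar B S = {(u, v). u \<in> univ B \<and> v \<in> univ B \<and>
     (\<forall>(t :: ('f, nat + nat) trm) e. wf_trm ar t \<and> range e \<subseteq> univ B \<longrightarrow>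
        (eval B (case_sum (\<lambda>_. u) e) t \<in> S \<longleftrightarrow> eval B (case_sum (\<lambda>_. v) e) t \<in> S))}"

lemma syntactic_conD:
  fixes t :: "('f, nat + nat) trm"
  assumes "(u, v) \<in> syntactic_con ar B S" "wf_trm ar t" "range e \<subseteq> univ B"
  shows "eval B (case_sum (\<lambda>_. u) e) t \<in> S \<longleftrightarrow> eval B (case_sum (\<lambda>_. v) e) t \<in> S"
  using assms unfolding syntactic_con_def by blast

lemma centralizesD:
  fixes t :: "('f, nat + nat) trm"
  assumes "centralizes ar A \<alpha> \<beta> \<delta>" "wf_trm ar t" "\<And>i. (a i, b i) \<in> \<alpha>" "\<And>j. (c j, d j) \<in> \<beta>"
    "(eval A (case_sum a c) t, eval A (case_sum a d) t) \<in> \<delta>"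
  shows "(eval A (case_sum b c) t, eval A (case_sum b d) t) \<in> \<delta>"
  using assms(1)[unfolded centralizes_def, rule_format, of t a b c d] assms(2-) by blast

lemma syntactic_con_Con:
  fixes B :: "('a, 'f) alg"
  assumes alg: "is_alg ar B"
  shows "syntactic_con ar B S \<in> Con ar B"
proof (rule ConI_unary[OF alg])
  fix f us x y vs
  assume len: "Suc (length us + length vs) = ar f"
    and us: "set us \<subseteq> univ B" and vs: "set vs \<subseteq> univ B" and xy: "(x, y) \<in> syntactic_con ar B S"
  let ?ws = "us @ vs"
  \<comment> \<open>Each occurrence of the moved variable becomes \<open>f\<close> with that
    variable in one place. The first \<open>length ?ws\<close> parameters hold
    \<open>us @ vs\<close>, so the old parameters shift up by that amount.\<close>
  let ?s = "case_sum
     (\<lambda>_. App f (map (\<lambda>i. Var (Inr i)) [0..<length us] @ Var (Inl 0) #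
               map (\<lambda>i. Var (Inr i)) [length us..<length ?ws]))
     (\<lambda>j. Var (Inr (j + length ?ws))) :: nat + nat \<Rightarrow> ('f, nat + nat) trm"
  have xyu: "x \<in> univ B" "y \<in> univ B" using xy unfolding syntactic_con_def by auto
  have ops_in: "ops B f (us @ z # vs) \<in> univ B" if "z \<in> univ B" for z
    using that alg len us vs unfolding is_alg_def by auto
  have "eval B (case_sum (\<lambda>_. ops B f (us @ x # vs)) e) t \<in> S \<longleftrightarrow>
        eval B (case_sum (\<lambda>_. ops B f (us @ y # vs)) e) t \<in> S"
    if t: "wf_trm ar t" and e: "range e \<subseteq> univ B" for t :: "('f, nat + nat) trm" and e
  proof -
    let ?e = "\<lambda>j. if j < length ?ws then ?ws ! j else e (j - length ?ws)"
    have "?e j \<in> univ B" for j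
      using e us vs nth_mem[of j ?ws] by (auto simp del: nth_mem)
    then have re: "range ?e \<subseteq> univ B" by blast
    have "wf_trm ar (subst ?s t)"
      using t len by (intro wf_subst) (auto split: sum.split)
    moreover have "eval B (case_sum (\<lambda>_. z) ?e) (subst ?s t) =
        eval B (case_sum (\<lambda>_. ops B f (us @ z # vs)) e) t" for z
    proof -
      have us_eq: "map ?e [0..<length us] = us"
        by (rule nth_equalityI) (auto simp: nth_append)
      have vs_eq: "map ?e [length us..<length ?ws] = vs"
        by (rule nth_equalityI) (auto simp: nth_append)
      have "(\<lambda>v. eval B (case_sum (\<lambda>_. z) ?e) (?s v)) = case_sum (\<lambda>_. ops B f (us @ z # vs)) e"
      proof
        fix v
        show "eval B (case_sum (\<lambda>_. z) ?e) (?s v) = case_sum (\<lambda>_. ops B f (us @ z # vs)) e v"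
        proof (cases v)
          case (Inl i)
          then show ?thesis using us_eq vs_eq by (simp add: comp_def del: length_append)
        next
          case (Inr j)
          then show ?thesis by simp
        qed
      qed
      then show ?thesis by (simp only: eval_subst)
    qed
    ultimately show ?thesis using syntactic_conD[OF xy _ re, of "subst ?s t"] by (simp only:)
  qed
  then show "(ops B f (us @ x # vs), ops B f (us @ y # vs)) \<in> syntactic_con ar B S"
    unfolding syntactic_con_def using ops_in xyu by simp
qed (auto simp: syntactic_con_def)

lemma saturates_syntactic_con:
  fixes B :: "('a, 'f) alg"
  assumes alg: "is_alg ar B" and E: "E \<subseteq> syntactic_con ar B S"
  shows "saturates E S"
  unfolding saturates_def
proof (intro allI impI, elim conjE)
  fix u v assume "(u, v) \<in> E" and u: "u \<in> S"
  then have uv: "(u, v) \<in> syntactic_con ar B S" using E by blast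
  obtain z where "z \<in> univ B" using alg unfolding is_alg_def by blast
  then have "range (\<lambda>_::nat. z) \<subseteq> univ B" "wf_trm ar (Var (Inl 0) :: ('f, nat + nat) trm)" by auto
  then have "eval B (case_sum (\<lambda>_. u) (\<lambda>_. z)) (Var (Inl 0) :: ('f, nat + nat) trm) \<in> S \<longleftrightarrow>
    eval B (case_sum (\<lambda>_. v) (\<lambda>_. z)) (Var (Inl 0) :: ('f, nat + nat) trm) \<in> S"
    using syntactic_conD[OF uv] by blast
  then show "v \<in> S" using u by simp
qed

text \<open>A term evaluated in the pair algebra yields the pair that the term condition tests:
  \<alpha>-arguments enter as diagonal pairs \<open>(a, a)\<close>, \<beta>-arguments as pairs
  \<open>(c, d)\<close>. For constant \<alpha>-tuples the condition says that the generators of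
  \<open>diag_con\<close> lie in the syntactic congruence.\<close>

lemma centralizes_iff_syntactic_con:
  fixes A :: "('a, 'f) alg"
  assumes alg: "is_alg ar A" and \<alpha>: "\<alpha> \<in> Con ar A" and \<beta>: "\<beta> \<in> Con ar A"
  shows "centralizes ar A \<alpha> \<beta> \<delta> \<longleftrightarrow>
    diag_con ar A \<beta> \<alpha> \<subseteq> syntactic_con ar (pairalg A \<beta>) \<delta>"
proof
  assume c: "centralizes ar A \<alpha> \<beta> \<delta>"
  let ?B = "pairalg A \<beta>"
  have B: "is_alg ar ?B" using pairalg_alg[OF alg \<beta>] .
  have "((x, x), (y, y)) \<in> syntactic_con ar ?B \<delta>" if xy: "(x, y) \<in> \<alpha>" for x y
  proof -
    have "eval ?B (case_sum (\<lambda>_. (q, q)) e) t \<in> \<delta>"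
      if t: "wf_trm ar t" "range e \<subseteq> univ ?B" "eval ?B (case_sum (\<lambda>_. (p, p)) e) t \<in> \<delta>" and pq: "(p, q) \<in> \<alpha>"
      for t :: "('f, nat + nat) trm" and e and p q
    proof -
      have f: "fst \<circ> case_sum (\<lambda>_::nat. (p, p)) e = case_sum (\<lambda>_. p) (fst \<circ> e)"
        "snd \<circ> case_sum (\<lambda>_::nat. (p, p)) e = case_sum (\<lambda>_. p) (snd \<circ> e)" for p
        by (auto split: sum.split)
      have "((fst \<circ> e) j, (snd \<circ> e) j) \<in> \<beta>" for j using t(2) by auto
      then show ?thesis
        unfolding eval_pairalg f by (rule centralizesD[OF c t(1) pq _ t(3)[unfolded eval_pairalg f]])
    qed
    note transfer = this
    have "eval ?B (case_sum (\<lambda>_. (x, x)) e) t \<in> \<delta> \<longleftrightarrow> eval ?B (case_sum (\<lambda>_. (y, y)) e) t \<in> \<delta>"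
      if "wf_trm ar t" "range e \<subseteq> univ ?B" for t :: "('f, nat + nat) trm" and e
      using transfer[OF that _ xy] transfer[OF that _ ConD(3)[OF \<alpha> xy]] by (rule iffI)
    moreover have "(x, x) \<in> \<beta>" "(y, y) \<in> \<beta>"
      using ConD(2)[OF \<beta>] Con_mem_univ[OF \<alpha> xy] by auto
    ultimately show ?thesis unfolding syntactic_con_def by simp
  qed
  then show "diag_con ar A \<beta> \<alpha> \<subseteq> syntactic_con ar ?B \<delta>"
    unfolding diag_con_def by (intro Cg_least syntactic_con_Con[OF B]) auto
next
  assume "diag_con ar A \<beta> \<alpha> \<subseteq> syntactic_con ar (pairalg A \<beta>) \<delta>"
  then have s: "saturates (diag_con ar A \<beta> \<alpha>) \<delta>"
    by (rule saturates_syntactic_con[OF pairalg_alg[OF alg \<beta>]])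
  show "centralizes ar A \<alpha> \<beta> \<delta>"
    unfolding centralizes_def
  proof (intro allI impI, elim conjE)
    fix t :: "('f, nat + nat) trm" and a b c d
    assume t: "wf_trm ar t" and ab: "\<forall>i. (a i, b i) \<in> \<alpha>" and cd: "\<forall>j. (c j, d j) \<in> \<beta>"
      and h: "(eval A (case_sum a c) t, eval A (case_sum a d) t) \<in> \<delta>"
    \<comment> \<open>Here the \<alpha>-arguments vary independently, whereas
      \<open>syntactic_con\<close> moves a single element; the gap closes because
      \<open>diag_con\<close> is compatible with terms.\<close>
    let ?e = "\<lambda>a. case_sum (\<lambda>i. (a i, a i)) (\<lambda>j. (c j, d j))"
    have "(?e a v, ?e b v) \<in> diag_con ar A \<beta> \<alpha>" for v
      using ab cd diag_con_gen[of _ _ \<alpha> ar A \<beta>] ConD(2)[OF diag_con_Con[OF alg \<alpha> \<beta>]] by (auto split: sum.split)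
    then have "(eval (pairalg A \<beta>) (?e a) t, eval (pairalg A \<beta>) (?e b) t) \<in> diag_con ar A \<beta> \<alpha>"
      using eval_Con[OF diag_con_Con[OF alg \<alpha> \<beta>]] t by blast
    moreover have "fst \<circ> ?e a = case_sum a c" "snd \<circ> ?e a = case_sum a d" for a :: "nat \<Rightarrow> 'a"
      by (auto split: sum.split)
    ultimately show "(eval A (case_sum b c) t, eval A (case_sum b d) t) \<in> \<delta>"
      using s h unfolding saturates_def eval_pairalg by auto
  qed
qed

lemma centralizes_saturates:
  assumes "is_alg ar A" "\<alpha> \<in> Con ar A" "\<beta> \<in> Con ar A" "centralizes ar A \<alpha> \<beta> \<delta>"
  shows "saturates (diag_con ar A \<beta> \<alpha>) \<delta>"
  using assms saturates_syntactic_con[OF pairalg_alg] centralizes_iff_syntactic_con by metis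

text \<open>Gumm's shifting lemma. The path \<open>p\<close>, \<open>r\<close>, \<open>s\<close>,
  \<open>q\<close> puts \<open>(p, q)\<close> into the join of \<open>\<eta> \<inter> \<nu>\<close>
  and \<mu>. As the pair also lies in \<eta>, the modular law puts it into the join of
  \<open>\<eta> \<inter> \<nu>\<close> and \<open>\<mu> \<inter> \<eta>\<close>, and both parts are
  below \<nu>.\<close>

lemma shifting:
  assumes alg: "is_alg ar B" and m: "con_modular ar B"
    and "\<eta> \<in> Con ar B" "\<mu> \<in> Con ar B" "\<nu> \<in> Con ar B"
    and le: "\<eta> \<inter> \<mu> \<subseteq> \<nu>"
    and pq: "(p, q) \<in> \<eta>" and rs: "(r, s) \<in> \<eta>" and "(p, r) \<in> \<mu>" "(q, s) \<in> \<mu>" and "(r, s) \<in> \<nu>"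
  shows "(p, q) \<in> \<nu>"
proof -
  have I: "\<eta> \<inter> \<nu> \<in> Con ar B" using assms by (intro Int_Con)
  let ?J = "cjoin ar B (\<eta> \<inter> \<nu>) \<mu>"
  have J: "?J \<in> Con ar B" using assms I by (intro cjoin_Con)
  have "(p, r) \<in> ?J" "(r, s) \<in> ?J" "(q, s) \<in> ?J"
    using assms cjoin_upper[of "\<eta> \<inter> \<nu>" ar B \<mu>] cjoin_upper(2)[of \<mu> ar B "\<eta> \<inter> \<nu>"] by auto
  then have "(p, q) \<in> ?J" using ConD(3,4)[OF J] by blast
  then have "(p, q) \<in> cjoin ar B (\<eta> \<inter> \<nu>) (\<mu> \<inter> \<eta>)"
    using m I assms pq unfolding con_modular_def by blast
  also have "\<dots> \<subseteq> \<nu>" using assms by (intro cjoin_least) auto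
  finally show ?thesis .
qed

text \<open>The pullback of \<delta> along a projection. With \<open>Delta A\<close> for \<delta> it
  is the kernel of the projection, which supplies sides of the rectangles for the shifting
  lemma.\<close>

lemma pairalg_kernel_Con:
  assumes alg: "is_alg ar A" and \<beta>: "\<beta> \<in> Con ar A" and \<delta>: "\<delta> \<in> Con ar A"
    and g: "g = fst \<or> g = snd"
  shows "{(u, v). u \<in> \<beta> \<and> v \<in> \<beta> \<and> (g u, g v) \<in> \<delta>} \<in> Con ar (pairalg A \<beta>)" (is "?K \<in> _")
proof (rule ConI)
  show "(u, u) \<in> ?K" if "u \<in> univ (pairalg A \<beta>)" for u
    using that g ConD(2)[OF \<delta>] Con_mem_univ[OF \<beta>] by (cases u) auto
  show "(v, u) \<in> ?K" if "(u, v) \<in> ?K" for u v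
    using that ConD(3)[OF \<delta>] by simp
  show "(u, w) \<in> ?K" if "(u, v) \<in> ?K" "(v, w) \<in> ?K" for u v w
    using that ConD(4)[OF \<delta>, of "g u" "g v" "g w"] by simp
  fix f us vs assume l: "length us = ar f" "list_all2 (\<lambda>x y. (x, y) \<in> ?K) us vs"
  have "set us \<subseteq> \<beta> \<and> set vs \<subseteq> \<beta>" by (rule list_all2_fst_snd[OF l(2)]) auto
  then have "ops (pairalg A \<beta>) f us \<in> \<beta>" "ops (pairalg A \<beta>) f vs \<in> \<beta>"
    using pairalg_alg[OF alg \<beta>] l list_all2_lengthD[OF l(2)] unfolding is_alg_def by simp_all
  moreover have "list_all2 (\<lambda>x y. (x, y) \<in> \<delta>) (map g us) (map g vs)"
    using l(2) by (auto simp: list_all2_map1 list_all2_map2 elim!: list_all2_mono)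
  then have "(ops A f (map g us), ops A f (map g vs)) \<in> \<delta>"
    using l(1) by (intro ConD(5)[OF \<delta>]) auto
  ultimately show "(ops (pairalg A \<beta>) f us, ops (pairalg A \<beta>) f vs) \<in> ?K"
    using g by auto
qed auto

lemma diag_con_first_coordinates:
  assumes alg: "is_alg ar A" and \<alpha>: "\<alpha> \<in> Con ar A" and \<beta>: "\<beta> \<in> Con ar A"
    and d: "((p, r), (q, s)) \<in> diag_con ar A \<beta> \<alpha>"
  shows "(p, q) \<in> \<alpha>"
proof -
  have "diag_con ar A \<beta> \<alpha> \<subseteq> {(u, v). u \<in> \<beta> \<and> v \<in> \<beta> \<and> (fst u, fst v) \<in> \<alpha>}"
    unfolding diag_con_def using Con_mem_univ[OF \<alpha>] ConD(2)[OF \<beta>]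
    by (intro Cg_least pairalg_kernel_Con[OF alg \<beta> \<alpha>]) auto
  then show ?thesis using d by auto
qed

text \<open>The core of commutator theory: one shift inside the algebra \<open>\<beta> \<le> A\<^sup>2\<close> pushes
  \<open>\<Delta>\<close>-related pairs \<open>(x,y), (x,z)\<close> onto the diagonal, whence \<open>(y,z) \<in> \<delta>\<close>; a second one moves
  \<open>\<delta>'\<close>-related rows along \<open>\<Delta>\<close>.\<close>
lemma centralizes_swap_mono:
  fixes A :: "('a, 'f) alg"
  assumes alg: "is_alg ar A" and \<alpha>: "\<alpha> \<in> Con ar A" and \<beta>: "\<beta> \<in> Con ar A"
    and m: "con_modular ar (pairalg A \<beta>)"
    and \<delta>: "\<delta> \<in> Con ar A" and \<delta>': "\<delta>' \<in> Con ar A" "\<delta> \<subseteq> \<delta>'"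
    and c: "centralizes ar A \<alpha> \<beta> \<delta>"
  shows "centralizes ar A \<beta> \<alpha> \<delta>'"
proof -
  let ?B = "pairalg A \<beta>" and ?D = "diag_con ar A \<beta> \<alpha>"
  have B: "is_alg ar ?B" using pairalg_alg[OF alg \<beta>] .
  have D: "?D \<in> Con ar ?B" using diag_con_Con[OF alg \<alpha> \<beta>] .
  have sat: "saturates ?D \<delta>" using centralizes_saturates[OF alg \<alpha> \<beta> c] .
  let ?\<eta>0 = "{(u, v). u \<in> \<beta> \<and> v \<in> \<beta> \<and> (fst u, fst v) \<in> Delta A}"
  let ?\<eta>1 = "{(u, v). u \<in> \<beta> \<and> v \<in> \<beta> \<and> (snd u, snd v) \<in> Delta A}"
  let ?\<nu> = "{(u, v). u \<in> \<beta> \<and> v \<in> \<beta> \<and> (snd u, snd v) \<in> \<delta>'}"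
  have K: "?\<eta>0 \<in> Con ar ?B" "?\<eta>1 \<in> Con ar ?B" "?\<nu> \<in> Con ar ?B"
    using pairalg_kernel_Con[OF alg \<beta>] Delta_Con[OF alg] \<delta>'(1) by blast+
  note \<beta>D = ConD[OF \<beta>] and \<beta>u = Con_mem_univ[OF \<beta>]
  have diag: "(y, z) \<in> \<delta>" if d: "((x, y), (x, z)) \<in> ?D" for x y z
  proof -
    have b: "(x, y) \<in> \<beta>" "(x, z) \<in> \<beta>" using Con_mem_univ[OF D d] by auto
    then have b': "(y, y) \<in> \<beta>" "(y, z) \<in> \<beta>" using \<beta>D(2,3,4) \<beta>u by blast+
    \<comment> \<open>Shifting along the kernel of the second projection trades the common first
      coordinate \<open>x\<close> for \<open>y\<close>.\<close>
    have "((y, y), (y, z)) \<in> ?D"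
    proof (rule shifting[OF B m K(1) K(2) D])
      show "?\<eta>0 \<inter> ?\<eta>1 \<subseteq> ?D"
        using ConD(2)[OF D] by (auto simp: Delta_def)
    qed (use b b' d \<beta>u in \<open>auto simp: Delta_def\<close>)
    then show ?thesis using sat b' ConD(2)[OF \<delta>] \<beta>u unfolding saturates_def by blast
  qed
  have key: "(r, s) \<in> \<delta>'" if d: "((p, r), (q, s)) \<in> ?D" and pq: "(p, q) \<in> \<delta>'" for p q r s
  proof -
    have b: "(p, r) \<in> \<beta>" "(q, s) \<in> \<beta>" using Con_mem_univ[OF D d] by auto
    then have b': "(p, p) \<in> \<beta>" "(q, q) \<in> \<beta>" using \<beta>D(2) \<beta>u by blast+
    have "((p, p), (q, q)) \<in> ?D" using diag_con_first_coordinates[OF alg \<alpha> \<beta> d] by (rule diag_con_gen)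
    \<comment> \<open>The opposite side is \<open>((p, p), (q, q))\<close>, whose second coordinates
      are \<delta>'-related by assumption. Both sides lie in \<open>?D\<close>, and moving from one
      to the other keeps first coordinates.\<close>
    have "((p, r), (q, s)) \<in> ?\<nu>"
    proof (rule shifting[OF B m D K(1) K(3)])
      show "?D \<inter> ?\<eta>0 \<subseteq> ?\<nu>" using diag \<delta>'(2) by (auto simp: Delta_def)
      show "((p, p), (q, q)) \<in> ?D" by fact
    qed (use b b' d pq \<beta>u in \<open>auto simp: Delta_def\<close>)
    then show ?thesis by simp
  qed
  show ?thesis
    unfolding centralizes_def
  proof (intro allI impI, elim conjE)
    fix t :: "('f, nat + nat) trm" and a b c d
    assume t: "wf_trm ar t" and ab: "\<forall>i. (a i, b i) \<in> \<beta>" and cd: "\<forall>j. (c j, d j) \<in> \<alpha>"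
      and h: "(eval A (case_sum a c) t, eval A (case_sum a d) t) \<in> \<delta>'"
    \<comment> \<open>The matrix is transposed: the \<beta>-tuples form elements
      \<open>(a i, b i)\<close> of the pair algebra and the \<alpha>-tuples sit on the diagonal.
      This exchanges the roles of the two congruences.\<close>
    let ?e = "\<lambda>c. case_sum (\<lambda>i. (a i, b i)) (\<lambda>j. (c j, c j))"
    have "(?e c v, ?e d v) \<in> ?D" for v
      using ab cd diag_con_gen[of _ _ \<alpha> ar A \<beta>] ConD(2)[OF D] by (auto split: sum.split)
    then have "(eval ?B (?e c) t, eval ?B (?e d) t) \<in> ?D"
      using eval_Con[OF D] t by blast
    moreover have "fst \<circ> ?e c = case_sum a c" "snd \<circ> ?e c = case_sum b c" for c :: "nat \<Rightarrow> 'a"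
      by (auto split: sum.split)
    ultimately have "((eval A (case_sum a c) t, eval A (case_sum b c) t),
        (eval A (case_sum a d) t, eval A (case_sum b d) t)) \<in> ?D"
      by (simp only: eval_pairalg)
    then show "(eval A (case_sum b c) t, eval A (case_sum b d) t) \<in> \<delta>'"
      using h by (rule key)
  qed
qed

section \<open>Finitely generated congruences\<close>

text \<open>Operations take finitely many arguments, so the directed union of the
  \<open>Cg ar A F\<close> over finite subsets \<open>F\<close> of \<open>R\<close> is already a
  congruence.\<close>

lemma Cg_finite_subset:
  assumes alg: "is_alg ar A" and R: "R \<subseteq> Nabla A" and xy: "(x, y) \<in> Cg ar A R"
  shows "\<exists>F\<subseteq>R. finite F \<and> (x, y) \<in> Cg ar A F"
proof -
  let ?U = "{(x, y). \<exists>F\<subseteq>R. finite F \<and> (x, y) \<in> Cg ar A F}"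
  have C: "Cg ar A F \<in> Con ar A" if "F \<subseteq> R" for F
    using that R by (intro Cg_Con[OF alg]) auto
  have "?U \<in> Con ar A"
  proof (rule ConI)
    show "?U \<subseteq> univ A \<times> univ A" using ConD(1)[OF C] by blast
    show "(x, x) \<in> ?U" if "x \<in> univ A" for x
      using that ConD(2)[OF C[of "{}"]] by auto
    show "(y, x) \<in> ?U" if "(x, y) \<in> ?U" for x y
      using that ConD(3)[OF C] by blast
    show "(x, z) \<in> ?U" if xy: "(x, y) \<in> ?U" and yz: "(y, z) \<in> ?U" for x y z
    proof -
      obtain F where F: "F \<subseteq> R" "finite F" "(x, y) \<in> Cg ar A F" using xy by auto
      obtain G where G: "G \<subseteq> R" "finite G" "(y, z) \<in> Cg ar A G" using yz by auto
      have FG: "F \<union> G \<subseteq> R" using F G by simp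
      have "(x, y) \<in> Cg ar A (F \<union> G)" "(y, z) \<in> Cg ar A (F \<union> G)"
        using F G Cg_mono[of F "F \<union> G" ar A] Cg_mono[of G "F \<union> G" ar A] by auto
      then have "(x, z) \<in> Cg ar A (F \<union> G)" using ConD(4)[OF C[OF FG]] by blast
      then show ?thesis using FG F(2) G(2) by blast
    qed
    fix f xs ys assume l: "length xs = ar f" "list_all2 (\<lambda>x y. (x, y) \<in> ?U) xs ys"
    have "\<exists>F\<subseteq>R. finite F \<and> list_all2 (\<lambda>x y. (x, y) \<in> Cg ar A F) xs ys"
      using l(2)
    proof (induction rule: list_all2_induct)
      case Nil
      then show ?case by auto
    next
      case (Cons x xs y ys)
      obtain F where F: "F \<subseteq> R" "finite F" "(x, y) \<in> Cg ar A F" using Cons(1) by auto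
      obtain G where G: "G \<subseteq> R" "finite G" "list_all2 (\<lambda>x y. (x, y) \<in> Cg ar A G) xs ys"
        using Cons.IH by auto
      have "list_all2 (\<lambda>x y. (x, y) \<in> Cg ar A (F \<union> G)) (x # xs) (y # ys)"
        using F(3) G(3) Cg_mono[of F "F \<union> G" ar A] Cg_mono[of G "F \<union> G" ar A]
        by (auto elim!: list_all2_mono)
      moreover have "F \<union> G \<subseteq> R" "finite (F \<union> G)" using F G by auto
      ultimately show ?case by blast
    qed
    then obtain F where F: "F \<subseteq> R" "finite F" "list_all2 (\<lambda>x y. (x, y) \<in> Cg ar A F) xs ys" by blast
    then have "(ops A f xs, ops A f ys) \<in> Cg ar A F" using ConD(5)[OF C[OF F(1)]] l(1) by blast
    then show "(ops A f xs, ops A f ys) \<in> ?U" using F by blast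
  qed
  moreover have "R \<subseteq> ?U"
  proof
    fix p assume p: "p \<in> R"
    have "p \<in> Cg ar A {p}" using Cg_upper[of "{p}" ar A] by simp
    then show "p \<in> ?U" using p by (cases p) (auto intro!: exI[of _ "{p}"])
  qed
  ultimately have "Cg ar A R \<subseteq> ?U" by (rule Cg_least)
  then show ?thesis using xy by auto
qed

lemma finite_subset_Cg:
  assumes alg: "is_alg ar A" and R: "R \<subseteq> Nabla A"
  shows "finite G \<Longrightarrow> G \<subseteq> Cg ar A R \<Longrightarrow> \<exists>F\<subseteq>R. finite F \<and> G \<subseteq> Cg ar A F"
proof (induction G rule: finite_induct)
  case empty
  then show ?case by auto
next
  case (insert p G)
  obtain F where F: "F \<subseteq> R" "finite F" "p \<in> Cg ar A F"
    using Cg_finite_subset[OF alg R, of "fst p" "snd p"] insert.prems by auto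
  obtain F' where F': "F' \<subseteq> R" "finite F'" "G \<subseteq> Cg ar A F'" using insert by auto
  have "insert p G \<subseteq> Cg ar A (F \<union> F')"
    using F(3) F'(3) Cg_mono[of F "F \<union> F'" ar A] Cg_mono[of F' "F \<union> F'" ar A] by blast
  then show ?case using F F' by (intro exI[of _ "F \<union> F'"]) auto
qed

text \<open>Each generator needs only finitely many pairs from \<open>\<Union>S\<close>, and each of
  these comes from one member of \<open>S\<close>.\<close>

lemma Cg_finite_compact:
  assumes alg: "is_alg ar A" and F: "finite F" "F \<subseteq> Nabla A"
  shows "Cg ar A F \<in> Kc ar A"
  unfolding Kc_def
proof (intro CollectI conjI allI impI)
  show "Cg ar A F \<in> Con ar A" using Cg_Con[OF alg F(2)] .
  fix S assume S: "S \<subseteq> Con ar A" and le: "Cg ar A F \<subseteq> cSup ar A S"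
  have "F \<subseteq> Cg ar A (\<Union>S)" using Cg_upper le unfolding cSup_def by fast
  then obtain G where G: "G \<subseteq> \<Union>S" "finite G" "F \<subseteq> Cg ar A G"
    using finite_subset_Cg[OF alg Union_subset_Nabla[OF S] F(1)] by blast
  obtain T where T: "finite T" "T \<subseteq> S" "G \<subseteq> \<Union>T" using finite_subset_Union[OF G(2,1)] by metis
  have "Cg ar A G \<subseteq> cSup ar A T" unfolding cSup_def using T(3) by (rule Cg_mono)
  then have "Cg ar A F \<subseteq> cSup ar A T"
    using G(3) T(2) S by (intro Cg_least cSup_Con[OF alg]) auto
  then show "\<exists>T\<subseteq>S. finite T \<and> Cg ar A F \<subseteq> cSup ar A T" using T by blast
qed

section \<open>Commutator calculus in semidegenerate modular algebras\<close>

text \<open>Semidegeneracy is recorded as it acts on quotients: a class closed under all operations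
  forces its congruence to be \<nabla>, on \<open>A\<close> and on each pair algebra. Modularity is
  recorded for the pair algebras, where the shifting lemma is applied.\<close>

locale semidegenerate_modular =
  fixes ar :: "'f \<Rightarrow> nat" and A :: "('a, 'f) alg"
  assumes alg: "is_alg ar A"
    and finite_signature: "finite (UNIV :: 'f set)"
    and comm_compact: "K_comm_closed ar A"
    and pairalg_modular: "\<beta> \<in> Con ar A \<Longrightarrow> con_modular ar (pairalg A \<beta>)"
    and idempotent_trivial: "\<theta> \<in> Con ar A \<Longrightarrow> x \<in> univ A \<Longrightarrow>
      (\<And>f. (x, ops A f (replicate (ar f) x)) \<in> \<theta>) \<Longrightarrow> \<theta> = Nabla A"
    and pairalg_idempotent_trivial: "\<beta> \<in> Con ar A \<Longrightarrow> \<Theta> \<in> Con ar (pairalg A \<beta>) \<Longrightarrow> u \<in> \<beta> \<Longrightarrow>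
      (\<And>f. (u, ops (pairalg A \<beta>) f (replicate (ar f) u)) \<in> \<Theta>) \<Longrightarrow> \<Theta> = Nabla (pairalg A \<beta>)"
begin

abbreviation join :: "'a rel \<Rightarrow> 'a rel \<Rightarrow> 'a rel" (infixl "\<squnion>" 65) where
  "\<alpha> \<squnion> \<beta> \<equiv> cjoin ar A \<alpha> \<beta>"

abbreviation commutator :: "'a rel \<Rightarrow> 'a rel \<Rightarrow> 'a rel" (infixl "\<odot>" 70) where
  "\<alpha> \<odot> \<beta> \<equiv> comm ar A \<alpha> \<beta>"

abbreviation cons :: "'a rel set" ("\<C>") where "\<C> \<equiv> Con ar A"
abbreviation top_con :: "'a rel" ("\<nabla>") where "\<nabla> \<equiv> Nabla A"
abbreviation neg_con :: "'a rel \<Rightarrow> 'a rel" where "neg_con \<equiv> cneg ar A"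

lemmas joinC [intro, simp] = cjoin_Con[OF alg]
lemmas nablaC [intro, simp] = Nabla_Con[OF alg]
lemmas deltaC [intro, simp] = Delta_Con[OF alg]
lemmas intC [intro, simp] = Int_Con[of _ ar A]

lemma join_le_iff: "\<gamma> \<in> \<C> \<Longrightarrow> \<alpha> \<squnion> \<beta> \<subseteq> \<gamma> \<longleftrightarrow> \<alpha> \<subseteq> \<gamma> \<and> \<beta> \<subseteq> \<gamma>"
  using cjoin_least[of \<gamma> ar A \<alpha> \<beta>] cjoin_upper[of \<alpha> ar A \<beta>] cjoin_upper(2)[of \<beta> ar A \<alpha>] by blast

lemma nabla_eqI: "\<gamma> \<in> \<C> \<Longrightarrow> \<nabla> \<subseteq> \<gamma> \<Longrightarrow> \<gamma> = \<nabla>"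
  using Con_subset_Nabla by blast

lemma centralizes_right: 
  assumes "\<alpha> \<in> \<C>" "\<beta> \<in> \<C>"
  shows "centralizes ar A \<alpha> \<beta> \<beta>"
  unfolding centralizes_def
proof (intro allI impI, elim conjE)
  fix t :: "('f, nat + nat) trm" and a b c d :: "nat \<Rightarrow> 'a"
  assume "wf_trm ar t" and ab: "\<forall>i. (a i, b i) \<in> \<alpha>" and cd: "\<forall>j. (c j, d j) \<in> \<beta>"
  then show "(eval A (case_sum b c) t, eval A (case_sum b d) t) \<in> \<beta>"
    using Con_mem_univ(2)[OF assms(1)] ConD(2)[OF assms(2)]
    by (intro eval_Con[OF assms(2)]) (force split: sum.split)
qed

text \<open>The term condition is stable under intersections, so
  \<open>\<alpha> \<odot> \<beta>\<close> is itself the least \<delta> that satisfies it. \<beta> is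
  one such \<delta>, which keeps the intersection from being empty.\<close>

lemma comm_properties:
  assumes "\<alpha> \<in> \<C>" "\<beta> \<in> \<C>"
  shows commC [intro, simp]: "\<alpha> \<odot> \<beta> \<in> \<C>"
    and centralizes_comm: "centralizes ar A \<alpha> \<beta> (\<alpha> \<odot> \<beta>)"
    and comm_le_right: "\<alpha> \<odot> \<beta> \<subseteq> \<beta>"
proof -
  let ?S = "{\<delta> \<in> \<C>. centralizes ar A \<alpha> \<beta> \<delta>}"
  have ne: "\<beta> \<in> ?S" using centralizes_right[OF assms] assms by simp
  then show "\<alpha> \<odot> \<beta> \<in> \<C>" unfolding comm_def by (intro Inter_Con) auto
  show "\<alpha> \<odot> \<beta> \<subseteq> \<beta>" unfolding comm_def using ne by blast
  show "centralizes ar A \<alpha> \<beta> (\<alpha> \<odot> \<beta>)"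
    unfolding centralizes_def
  proof (intro allI impI, elim conjE)
    fix t :: "('f, nat + nat) trm" and a b c d
    assume t: "wf_trm ar t" and ab: "\<forall>i. (a i, b i) \<in> \<alpha>" and cd: "\<forall>j. (c j, d j) \<in> \<beta>"
      and h: "(eval A (case_sum a c) t, eval A (case_sum a d) t) \<in> \<alpha> \<odot> \<beta>"
    show "(eval A (case_sum b c) t, eval A (case_sum b d) t) \<in> \<alpha> \<odot> \<beta>"
      unfolding comm_def
    proof
      fix \<delta> assume \<delta>: "\<delta> \<in> ?S"
      then have "(eval A (case_sum a c) t, eval A (case_sum a d) t) \<in> \<delta>"
        using h unfolding comm_def by blast
      then show "(eval A (case_sum b c) t, eval A (case_sum b d) t) \<in> \<delta>"
        using \<delta> ab cd centralizesD[OF _ t, of A \<alpha> \<beta> \<delta> a b c d] by simp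
    qed
  qed
qed

lemma comm_least: "\<delta> \<in> \<C> \<Longrightarrow> centralizes ar A \<alpha> \<beta> \<delta> \<Longrightarrow> \<alpha> \<odot> \<beta> \<subseteq> \<delta>"
  unfolding comm_def by blast

lemma comm_commute:
  assumes "\<alpha> \<in> \<C>" "\<beta> \<in> \<C>"
  shows "\<alpha> \<odot> \<beta> = \<beta> \<odot> \<alpha>"
proof -
  have "\<beta> \<odot> \<alpha> \<subseteq> \<alpha> \<odot> \<beta>" if "\<alpha> \<in> \<C>" "\<beta> \<in> \<C>" for \<alpha> \<beta>
    using that centralizes_swap_mono[OF alg that pairalg_modular[OF that(2)] _ _ _ centralizes_comm[OF that]]
    by (intro comm_least) auto
  then show ?thesis using assms by blast
qed

text \<open>\<open>centralizes_swap_mono\<close> enlarges \<delta> while exchanging the two sides,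
  so it is applied to \<open>\<beta> \<odot> \<alpha>\<close>, which has been exchanged
  beforehand.\<close>

lemma comm_le_iff:
  assumes "\<alpha> \<in> \<C>" "\<beta> \<in> \<C>" "\<delta> \<in> \<C>"
  shows "\<alpha> \<odot> \<beta> \<subseteq> \<delta> \<longleftrightarrow> centralizes ar A \<alpha> \<beta> \<delta>"
proof
  assume "\<alpha> \<odot> \<beta> \<subseteq> \<delta>"
  then have "\<beta> \<odot> \<alpha> \<subseteq> \<delta>" using comm_commute assms by simp
  then show "centralizes ar A \<alpha> \<beta> \<delta>"
    using centralizes_swap_mono[OF alg assms(2,1) pairalg_modular[OF assms(1)] _ assms(3) _
        centralizes_comm[OF assms(2,1)]] assms by blast
qed (use assms comm_least in blast)

lemma comm_le_left: "\<alpha> \<in> \<C> \<Longrightarrow> \<beta> \<in> \<C> \<Longrightarrow> \<alpha> \<odot> \<beta> \<subseteq> \<alpha>"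
  using comm_commute comm_le_right by metis

text \<open>A smaller \<alpha> gives a smaller \<open>diag_con\<close>, whose inclusion in the
  syntactic congruence persists; the other argument follows by commutativity.\<close>

lemma comm_mono:
  assumes C: "\<alpha> \<in> \<C>" "\<beta> \<in> \<C>" "\<alpha>' \<in> \<C>" "\<beta>' \<in> \<C>" and le: "\<alpha> \<subseteq> \<alpha>'" "\<beta> \<subseteq> \<beta>'"
  shows "\<alpha> \<odot> \<beta> \<subseteq> \<alpha>' \<odot> \<beta>'"
proof -
  have left: "\<alpha> \<odot> \<beta> \<subseteq> \<alpha>' \<odot> \<beta>" if "\<alpha> \<in> \<C>" "\<alpha>' \<in> \<C>" "\<beta> \<in> \<C>" "\<alpha> \<subseteq> \<alpha>'" for \<alpha> \<alpha>' \<beta>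
    using that diag_con_mono[OF that(4), of ar A \<beta>] centralizes_comm[OF that(2,3)]
    by (intro comm_least) (auto simp: centralizes_iff_syntactic_con[OF alg])
  show ?thesis
    using left[OF C(1,3,2) le(1)] left[OF C(2,4,3) le(2)] comm_commute C by simp
qed

text \<open>The pairs \<open>(x, y)\<close> whose diagonal images are related by \<open>?E\<close>
  form a congruence of \<open>A\<close>. It contains \<alpha> and \<beta>, hence their join, so
  \<open>?E\<close> contains the generators of \<open>diag_con\<close> for the join.\<close>

lemma comm_join_le:
  assumes C: "\<alpha> \<in> \<C>" "\<beta> \<in> \<C>" "\<gamma> \<in> \<C>" "\<delta> \<in> \<C>" and "\<alpha> \<odot> \<gamma> \<subseteq> \<delta>" "\<beta> \<odot> \<gamma> \<subseteq> \<delta>"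
  shows "(\<alpha> \<squnion> \<beta>) \<odot> \<gamma> \<subseteq> \<delta>"
proof -
  let ?B = "pairalg A \<gamma>"
  let ?E = "syntactic_con ar ?B \<delta>"
  have E: "?E \<in> Con ar ?B" using C by (intro syntactic_con_Con pairalg_alg alg)
  have gen: "((x, x), (y, y)) \<in> ?E" if "(x, y) \<in> \<alpha> \<or> (x, y) \<in> \<beta>" for x y
    using that assms diag_con_gen[of x y _ ar A \<gamma>]
    by (auto simp: comm_le_iff centralizes_iff_syntactic_con[OF alg])
  let ?D = "{(x, y). x \<in> univ A \<and> y \<in> univ A \<and> ((x, x), (y, y)) \<in> ?E}"
  have D: "?D \<in> \<C>"
  proof (rule ConI)
    show "(x, x) \<in> ?D" if "x \<in> univ A" for x
      using that ConD(2)[OF E] ConD(2)[OF C(3)] by simp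
    show "(y, x) \<in> ?D" if "(x, y) \<in> ?D" for x y
      using that ConD(3)[OF E] by simp
    show "(x, z) \<in> ?D" if "(x, y) \<in> ?D" "(y, z) \<in> ?D" for x y z
      using that ConD(4)[OF E, of "(x, x)" "(y, y)" "(z, z)"] by simp
    fix f xs ys assume l: "length xs = ar f" "list_all2 (\<lambda>x y. (x, y) \<in> ?D) xs ys"
    have "list_all2 (\<lambda>x y. (x, y) \<in> ?E) (map (\<lambda>x. (x, x)) xs) (map (\<lambda>x. (x, x)) ys)"
      using l(2) by (auto simp: list_all2_map1 list_all2_map2 elim!: list_all2_mono)
    then have "(ops ?B f (map (\<lambda>x. (x, x)) xs), ops ?B f (map (\<lambda>x. (x, x)) ys)) \<in> ?E"
      using l(1) by (intro ConD(5)[OF E]) auto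
    moreover have "set xs \<subseteq> univ A \<and> set ys \<subseteq> univ A" by (rule list_all2_fst_snd[OF l(2)]) auto
    ultimately show "(ops A f xs, ops A f ys) \<in> ?D"
      using alg l(1) list_all2_lengthD[OF l(2)] unfolding is_alg_def by (simp add: comp_def)
  qed auto
  have "\<alpha> \<subseteq> ?D" "\<beta> \<subseteq> ?D" using gen Con_mem_univ[OF C(1)] Con_mem_univ[OF C(2)] by auto
  then have "\<alpha> \<squnion> \<beta> \<subseteq> ?D" using D by (intro cjoin_least)
  then have "diag_con ar A \<gamma> (\<alpha> \<squnion> \<beta>) \<subseteq> ?E"
    unfolding diag_con_def using E by (intro Cg_least) auto
  then show ?thesis using C by (simp add: comm_le_iff centralizes_iff_syntactic_con[OF alg])
qed

text \<open>The diagonal of \<open>\<gamma> \<le> A\<^sup>2\<close> lies in one class of \<open>\<Delta>\<close>, so that class is a one-element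
  subalgebra of the quotient; semidegeneracy makes the quotient trivial.\<close>
lemma comm_Nabla:
  assumes \<gamma>: "\<gamma> \<in> \<C>"
  shows "\<gamma> \<odot> \<nabla> = \<gamma>"
proof
  show "\<gamma> \<odot> \<nabla> \<subseteq> \<gamma>" using \<gamma> by (intro comm_le_left) auto
  let ?B = "pairalg A \<gamma>" and ?D = "diag_con ar A \<gamma> \<nabla>"
  obtain a where a: "a \<in> univ A" using alg unfolding is_alg_def by blast
  have "?D = Nabla ?B"
  proof (rule pairalg_idempotent_trivial[OF \<gamma>])
    show "?D \<in> Con ar ?B" using \<gamma> by (intro diag_con_Con alg) auto
    show "(a, a) \<in> \<gamma>" using ConD(2)[OF \<gamma> a] .
    fix f
    have "set (replicate (ar f) a) \<subseteq> univ A" using a by auto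
    then have "ops A f (replicate (ar f) a) \<in> univ A" using alg unfolding is_alg_def by simp
    then show "((a, a), ops ?B f (replicate (ar f) (a, a))) \<in> ?D"
      using a diag_con_gen[of _ _ \<nabla> ar A \<gamma>] by (simp add: Nabla_def)
  qed
  moreover have "saturates ?D (\<nabla> \<odot> \<gamma>)"
    using \<gamma> by (intro centralizes_saturates[OF alg] centralizes_comm) auto
  moreover have "(a, a) \<in> \<nabla> \<odot> \<gamma>" "(a, a) \<in> \<gamma>"
    using ConD(2)[OF \<gamma> a] ConD(2)[OF commC[OF nablaC \<gamma>] a] by blast+
  moreover have "(u, v) \<in> Nabla ?B" if "u \<in> \<gamma>" "v \<in> \<gamma>" for u v
    using that by (simp add: Nabla_def)
  ultimately have "\<gamma> \<subseteq> \<nabla> \<odot> \<gamma>"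
    unfolding saturates_def by blast
  then show "\<gamma> \<subseteq> \<gamma> \<odot> \<nabla>" using comm_commute[OF \<gamma> nablaC] by simp
qed

text \<open>Since \<open>\<gamma> \<odot> \<nabla> = \<gamma>\<close>, multiplying \<gamma> by both
  parts of a cover of \<nabla> loses nothing. Many inclusions below are tested on a cover in this
  way.\<close>

lemma le_of_cover:
  assumes C: "\<alpha> \<in> \<C>" "\<beta> \<in> \<C>" "\<gamma> \<in> \<C>" "\<delta> \<in> \<C>" and cover: "\<alpha> \<squnion> \<beta> = \<nabla>"
    and le: "\<gamma> \<odot> \<alpha> \<subseteq> \<delta>" "\<gamma> \<odot> \<beta> \<subseteq> \<delta>"
  shows "\<gamma> \<subseteq> \<delta>"
proof -
  have "(\<alpha> \<squnion> \<beta>) \<odot> \<gamma> \<subseteq> \<delta>"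
    using C le comm_commute by (intro comm_join_le) auto
  then show ?thesis using cover comm_Nabla[OF C(3)] comm_commute C by simp
qed

text \<open>As for comaximal ideals: multiplied by \<phi>, the meet is bounded through its factor
  \<psi>, and multiplied by \<psi> through its factor \<phi>.\<close>

lemma Int_le_comm:
  assumes "\<phi> \<in> \<C>" "\<psi> \<in> \<C>" "\<phi> \<squnion> \<psi> = \<nabla>"
  shows "\<phi> \<inter> \<psi> \<subseteq> \<phi> \<odot> \<psi>"
proof (rule le_of_cover[OF assms(1,2) _ _ assms(3)])
  show "(\<phi> \<inter> \<psi>) \<odot> \<phi> \<subseteq> \<phi> \<odot> \<psi>"
    using comm_mono[of "\<phi> \<inter> \<psi>" \<phi> \<psi> \<phi>] comm_commute[of \<phi> \<psi>] assms by auto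
  show "(\<phi> \<inter> \<psi>) \<odot> \<psi> \<subseteq> \<phi> \<odot> \<psi>"
    using assms by (intro comm_mono) auto
qed (use assms in auto)

section \<open>Complemented congruences\<close>

definition complementary :: "'a rel \<Rightarrow> 'a rel \<Rightarrow> bool" where
  "complementary \<alpha> \<beta> \<longleftrightarrow> \<alpha> \<in> \<C> \<and> \<beta> \<in> \<C> \<and> \<alpha> \<inter> \<beta> = Delta A \<and> \<alpha> \<squnion> \<beta> = \<nabla>"

lemma complementaryI:
  assumes "\<alpha> \<in> \<C>" "\<beta> \<in> \<C>" "\<alpha> \<squnion> \<beta> = \<nabla>" "\<alpha> \<odot> \<beta> \<subseteq> Delta A"
  shows "complementary \<alpha> \<beta>"
  using assms Int_le_comm[OF assms(1-3)] Delta_subset_Con[of "\<alpha> \<inter> \<beta>" ar A]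
  unfolding complementary_def by auto

lemma complementary_comm:
  assumes "complementary \<alpha> \<beta>" "\<gamma> \<in> \<C>"
  shows "\<alpha> \<odot> \<beta> \<subseteq> \<gamma>" "\<beta> \<odot> \<alpha> \<subseteq> \<gamma>"
proof -
  have *: "\<alpha> \<in> \<C>" "\<beta> \<in> \<C>" "\<alpha> \<inter> \<beta> = Delta A" using assms unfolding complementary_def by auto
  then show "\<alpha> \<odot> \<beta> \<subseteq> \<gamma>"
    using comm_le_left[OF *(1,2)] comm_le_right[OF *(1,2)] Delta_subset_Con[OF assms(2)] by blast
  then show "\<beta> \<odot> \<alpha> \<subseteq> \<gamma>" using comm_commute * by simp
qed

lemma complementary_sym: "complementary \<alpha> \<beta> \<Longrightarrow> complementary \<beta> \<alpha>"
  unfolding complementary_def using cjoin_commute by blast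

text \<open>\<beta> is tested on the cover by \<alpha> and \<gamma>: its product with \<alpha> is
  trivial and its product with \<gamma> is below \<gamma>. Uniqueness of complements, and so the
  description in \<open>cneg\<close>, rests on this.\<close>

lemma complementary_le:
  assumes c: "complementary \<alpha> \<beta>" and "\<gamma> \<in> \<C>" "\<nabla> \<subseteq> \<alpha> \<squnion> \<gamma>"
  shows "\<beta> \<subseteq> \<gamma>"
proof -
  have C: "\<alpha> \<in> \<C>" "\<beta> \<in> \<C>" using c unfolding complementary_def by auto
  then have "\<alpha> \<squnion> \<gamma> = \<nabla>" using assms by (intro nabla_eqI) auto
  then show ?thesis
    using complementary_comm(2)[OF c assms(2)] comm_le_right[OF C(2) assms(2)]
    by (rule le_of_cover[OF C(1) assms(2) C(2) assms(2)])
qed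

lemma cneg_eq: "complementary \<alpha> \<beta> \<Longrightarrow> neg_con \<alpha> = \<beta>"
  unfolding cneg_def
proof (rule the_equality)
  assume c: "complementary \<alpha> \<beta>"
  then show "\<beta> \<in> \<C> \<and> \<alpha> \<inter> \<beta> = Delta A \<and> \<alpha> \<squnion> \<beta> = \<nabla>" unfolding complementary_def by simp
  fix \<gamma> assume "\<gamma> \<in> \<C> \<and> \<alpha> \<inter> \<gamma> = Delta A \<and> \<alpha> \<squnion> \<gamma> = \<nabla>"
  then have "complementary \<alpha> \<gamma>" using c unfolding complementary_def by simp
  then show "\<gamma> = \<beta>"
    using c complementary_le[of \<alpha> \<beta> \<gamma>] complementary_le[of \<alpha> \<gamma> \<beta>]
    unfolding complementary_def by auto
qed

lemma BCon_iff: "\<alpha> \<in> BCon ar A \<longleftrightarrow> (\<exists>\<beta>. complementary \<alpha> \<beta>)"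
  unfolding BCon_def complementary_def by blast

lemma BCon_cneg: "\<alpha> \<in> BCon ar A \<Longrightarrow> complementary \<alpha> (neg_con \<alpha>)"
  using BCon_iff cneg_eq by blast

lemma cneg_BCon: "\<alpha> \<in> BCon ar A \<Longrightarrow> neg_con \<alpha> \<in> BCon ar A"
  using BCon_iff BCon_cneg complementary_sym by blast

lemma BConC [intro, simp]: "\<alpha> \<in> BCon ar A \<Longrightarrow> \<alpha> \<in> \<C>"
  unfolding BCon_def by simp

lemma Delta_BCon: "Delta A \<in> BCon ar A"
proof -
  have "Delta A \<squnion> \<nabla> = \<nabla>" using cjoin_upper(2)[of \<nabla> ar A "Delta A"] by (intro nabla_eqI) auto
  then have "complementary (Delta A) \<nabla>"
    using comm_le_left by (intro complementaryI) auto
  then show ?thesis using BCon_iff by blast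
qed

lemma join_BCon:
  assumes "\<alpha> \<in> BCon ar A" "\<beta> \<in> BCon ar A"
  shows "\<alpha> \<squnion> \<beta> \<in> BCon ar A"
proof -
  obtain \<alpha>' \<beta>' where c: "complementary \<alpha> \<alpha>'" "complementary \<beta> \<beta>'" using assms BCon_iff by blast
  then have C: "\<alpha> \<in> \<C>" "\<alpha>' \<in> \<C>" "\<beta> \<in> \<C>" "\<beta>' \<in> \<C>" and J: "\<alpha> \<squnion> \<alpha>' = \<nabla>" "\<beta> \<squnion> \<beta>' = \<nabla>"
    unfolding complementary_def by auto
  \<comment> \<open>De Morgan: the meet of the complements is to complement the join.\<close>
  let ?m = "\<alpha>' \<inter> \<beta>'"
  let ?d = "\<alpha> \<squnion> \<beta> \<squnion> ?m"
  have d: "?d \<in> \<C>" using C by auto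
  have le: "\<alpha> \<subseteq> ?d" "\<beta> \<subseteq> ?d" "?m \<subseteq> ?d" using join_le_iff[OF d] d C join_le_iff[of ?d "\<alpha> \<squnion> \<beta>" ?m]
     join_le_iff[of ?d \<alpha> \<beta>] by auto
  have "\<alpha>' \<odot> \<beta>' \<subseteq> ?m" using C comm_le_left comm_le_right by auto
  \<comment> \<open>Tested on the cover by \<beta> and \<beta>': the first product is below \<beta>,
    the second below \<open>?m\<close>.\<close>
  then have "\<alpha>' \<subseteq> ?d"
    using comm_le_right[OF C(2,3)] le by (intro le_of_cover[OF C(3,4,2) d J(2)]) auto
  then have "?d = \<nabla>"
    using J(1) le d join_le_iff[OF d, of \<alpha> \<alpha>'] by (intro nabla_eqI) auto
  moreover have "(\<alpha> \<squnion> \<beta>) \<odot> ?m \<subseteq> Delta A"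
  proof (rule comm_join_le)
    show "\<alpha> \<odot> ?m \<subseteq> Delta A"
      using comm_mono[of \<alpha> ?m \<alpha> \<alpha>'] complementary_comm(1)[OF c(1) deltaC] C by blast
    show "\<beta> \<odot> ?m \<subseteq> Delta A"
      using comm_mono[of \<beta> ?m \<beta> \<beta>'] complementary_comm(1)[OF c(2) deltaC] C by blast
  qed (use C in auto)
  ultimately have "complementary (\<alpha> \<squnion> \<beta>) ?m" using C by (intro complementaryI) auto
  then show ?thesis using BCon_iff by blast
qed

lemma cSup_insert:
  assumes "\<alpha> \<in> \<C>" "T \<subseteq> \<C>"
  shows "cSup ar A (insert \<alpha> T) = \<alpha> \<squnion> cSup ar A T"
proof
  have T: "cSup ar A T \<in> \<C>" "cSup ar A (insert \<alpha> T) \<in> \<C>" using assms by (auto intro!: cSup_Con[OF alg])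
  show "cSup ar A (insert \<alpha> T) \<subseteq> \<alpha> \<squnion> cSup ar A T"
  proof (rule cSup_least)
    fix \<beta> assume "\<beta> \<in> insert \<alpha> T"
    then show "\<beta> \<subseteq> \<alpha> \<squnion> cSup ar A T"
      using cjoin_upper(1)[of \<alpha> ar A "cSup ar A T"] cjoin_upper(2)[of "cSup ar A T" ar A \<alpha>]
        cSup_upper[of \<beta> T ar A] by blast
  qed (use assms T in auto)
  show "\<alpha> \<squnion> cSup ar A T \<subseteq> cSup ar A (insert \<alpha> T)"
    using T cSup_upper[of _ "insert \<alpha> T" ar A] by (intro cjoin_least cSup_least) auto
qed

lemma finite_cSup_BCon:
  "finite T \<Longrightarrow> T \<subseteq> BCon ar A \<Longrightarrow> cSup ar A T \<in> BCon ar A"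
proof (induction T rule: finite_induct)
  case empty
  \<comment> \<open>The empty join is the least congruence, not the empty relation.\<close>
  have "cSup ar A {} = Delta A"
    using cSup_least[of "Delta A" ar A "{}"] Delta_subset_Con[OF cSup_Con[OF alg, of "{}"]] by auto
  then show ?case using Delta_BCon by simp
next
  case (insert \<alpha> T)
  then have "cSup ar A (insert \<alpha> T) = \<alpha> \<squnion> cSup ar A T" by (intro cSup_insert) auto
  then show ?case using insert join_BCon by simp
qed

text \<open>For a fixed element \<open>a\<close>, the pairs of \<open>a\<close> with the values
  \<open>f(a, ..., a)\<close> generate a congruence in whose quotient the class of \<open>a\<close>
  is a one-element subalgebra. The signature being finite, there are finitely many such
  pairs.\<close>

lemma Nabla_finite_Cg: "\<exists>F. finite F \<and> F \<subseteq> \<nabla> \<and> Cg ar A F = \<nabla>"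
proof -
  obtain a where a: "a \<in> univ A" using alg unfolding is_alg_def by blast
  let ?F = "range (\<lambda>f. (a, ops A f (replicate (ar f) a)))"
  have "ops A f (replicate (ar f) a) \<in> univ A" for f
    using a alg unfolding is_alg_def by (auto simp: set_replicate_conv_if)
  then have F: "?F \<subseteq> \<nabla>" using a by (auto simp: Nabla_def)
  moreover have "Cg ar A ?F = \<nabla>"
    using Cg_upper[of ?F ar A] by (intro idempotent_trivial[OF Cg_Con[OF alg F] a]) auto
  ultimately show ?thesis using finite_signature by blast
qed

lemma Nabla_Kc: "\<nabla> \<in> Kc ar A"
  using Nabla_finite_Cg Cg_finite_compact[OF alg] by metis

lemma KcD:
  assumes "\<kappa> \<in> Kc ar A" "S \<subseteq> \<C>" "\<kappa> \<subseteq> cSup ar A S"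
  shows "\<exists>T\<subseteq>S. finite T \<and> \<kappa> \<subseteq> cSup ar A T"
  using assms unfolding Kc_def by blast

text \<open>Finitely many pairs from \<open>\<alpha> \<union> \<beta>\<close> already generate
  \<nabla>; sorting them by origin gives the two compact parts.\<close>

lemma compact_cover:
  assumes "\<alpha> \<in> \<C>" "\<beta> \<in> \<C>" "\<alpha> \<squnion> \<beta> = \<nabla>"
  shows "\<exists>\<alpha>' \<beta>'. \<alpha>' \<in> Kc ar A \<and> \<beta>' \<in> Kc ar A \<and> \<alpha>' \<subseteq> \<alpha> \<and> \<beta>' \<subseteq> \<beta> \<and> \<alpha>' \<squnion> \<beta>' = \<nabla>"
proof -
  obtain G where G: "finite G" "G \<subseteq> \<nabla>" "Cg ar A G = \<nabla>" using Nabla_finite_Cg by blast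
  have "\<alpha> \<union> \<beta> \<subseteq> \<nabla>" using assms Con_subset_Nabla by blast
  moreover have "G \<subseteq> Cg ar A (\<alpha> \<union> \<beta>)" using G assms(3) unfolding cjoin_def by simp
  ultimately obtain F where F: "F \<subseteq> \<alpha> \<union> \<beta>" "finite F" "G \<subseteq> Cg ar A F"
    using finite_subset_Cg[OF alg _ G(1)] by metis
  have sub: "F \<inter> \<alpha> \<subseteq> \<nabla>" "F \<inter> \<beta> \<subseteq> \<nabla>" using assms Con_subset_Nabla by blast+
  let ?\<alpha> = "Cg ar A (F \<inter> \<alpha>)" and ?\<beta> = "Cg ar A (F \<inter> \<beta>)"
  have J: "?\<alpha> \<squnion> ?\<beta> \<in> \<C>" using sub by (intro joinC Cg_Con alg)
  have "F \<subseteq> ?\<alpha> \<squnion> ?\<beta>"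
    using F(1) Cg_upper[of "F \<inter> \<alpha>" ar A] Cg_upper[of "F \<inter> \<beta>" ar A]
      cjoin_upper(1)[of ?\<alpha> ar A ?\<beta>] cjoin_upper(2)[of ?\<beta> ar A ?\<alpha>] by blast
  then have "Cg ar A F \<subseteq> ?\<alpha> \<squnion> ?\<beta>" using J by (intro Cg_least)
  then have "\<nabla> \<subseteq> ?\<alpha> \<squnion> ?\<beta>" using G(3) F(3) J Cg_least[of "?\<alpha> \<squnion> ?\<beta>" ar A G] by simp
  then have "?\<alpha> \<squnion> ?\<beta> = \<nabla>" by (rule nabla_eqI[OF J])
  moreover have "?\<alpha> \<in> Kc ar A" "?\<beta> \<in> Kc ar A"
    using Cg_finite_compact[OF alg] F(2) sub by auto
  moreover have "?\<alpha> \<subseteq> \<alpha>" "?\<beta> \<subseteq> \<beta>" using assms by (simp_all add: Cg_least)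
  ultimately show ?thesis by blast
qed

section \<open>Joins of complemented congruences below a congruence; maximal congruences\<close>

lemma diamondC [intro, simp]: "diamond ar A \<phi> \<in> \<C>"
  unfolding diamond_def by (rule cSup_Con[OF alg]) auto

lemma le_diamond: "\<alpha> \<in> BCon ar A \<Longrightarrow> \<alpha> \<subseteq> \<phi> \<Longrightarrow> \<alpha> \<subseteq> diamond ar A \<phi>"
  unfolding diamond_def by (rule cSup_upper) simp

text \<open>Compactness selects finitely many complemented congruences below \<phi>, and their join
  is again complemented and below \<phi>.\<close>

lemma compact_le_join_diamond:
  assumes \<kappa>: "\<kappa> \<in> Kc ar A" and C: "\<sigma> \<in> \<C>" "\<phi> \<in> \<C>" and le: "\<kappa> \<subseteq> \<sigma> \<squnion> diamond ar A \<phi>"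
  shows "\<exists>\<alpha>\<in>BCon ar A. \<alpha> \<subseteq> \<phi> \<and> \<kappa> \<subseteq> \<sigma> \<squnion> \<alpha>"
proof -
  let ?S = "{\<alpha> \<in> BCon ar A. \<alpha> \<subseteq> \<phi>}"
  have S: "?S \<subseteq> \<C>" by auto
  have "\<kappa> \<subseteq> cSup ar A (insert \<sigma> ?S)"
    using le cSup_insert[OF C(1) S] unfolding diamond_def by simp
  then obtain T where T: "T \<subseteq> insert \<sigma> ?S" "finite T" "\<kappa> \<subseteq> cSup ar A T"
    using KcD[OF \<kappa>, of "insert \<sigma> ?S"] C S by auto
  \<comment> \<open>The finite family may contain \<sigma>, which is not assumed complemented; it is
    taken out here and put back by the join.\<close>
  let ?\<alpha> = "cSup ar A (T - {\<sigma>})"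
  have T': "T - {\<sigma>} \<subseteq> ?S" using T(1) by auto
  then have B: "?\<alpha> \<in> BCon ar A" using T(2) by (intro finite_cSup_BCon) auto
  have "?\<alpha> \<subseteq> \<phi>" using T' C by (intro cSup_least) auto
  moreover have "cSup ar A T \<subseteq> cSup ar A (insert \<sigma> (T - {\<sigma>}))"
    unfolding cSup_def by (rule Cg_mono) auto
  then have "\<kappa> \<subseteq> \<sigma> \<squnion> ?\<alpha>" using T(3) cSup_insert[OF C(1), of "T - {\<sigma>}"] T' S by auto
  ultimately show ?thesis using B by blast
qed

lemma maximal_con_exists:
  assumes \<sigma>: "\<sigma> \<in> \<C>" "\<sigma> \<noteq> \<nabla>"
  shows "\<exists>\<phi>. maximal_con ar A \<phi> \<and> \<sigma> \<subseteq> \<phi>"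
proof -
  let ?P = "{\<psi> \<in> \<C>. \<sigma> \<subseteq> \<psi> \<and> \<psi> \<noteq> \<nabla>}"
  have "\<exists>M\<in>?P. \<forall>X\<in>?P. M \<subseteq> X \<longrightarrow> X = M"
  proof (rule subset_Zorn)
    fix Ch assume ch: "subset.chain ?P Ch"
    \<comment> \<open>\<sigma> is added so that the empty chain, too, gets an upper bound above
      \<sigma>.\<close>
    then have ch': "subset.chain ?P (insert \<sigma> Ch)"
      using \<sigma> unfolding subset_chain_def by auto
    let ?U = "cSup ar A (insert \<sigma> Ch)"
    have sub: "insert \<sigma> Ch \<subseteq> \<C>" using ch' unfolding subset_chain_def by blast
    have U: "?U \<in> \<C>" using sub by (intro cSup_Con[OF alg])
    have "?U \<noteq> \<nabla>"
    proof
      assume "?U = \<nabla>"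
      then obtain T where T: "T \<subseteq> insert \<sigma> Ch" "finite T" "\<nabla> \<subseteq> cSup ar A T"
        using KcD[OF Nabla_Kc sub] by auto
      \<comment> \<open>A nonempty finite chain contains its own union, so this union is a proper
        congruence and cannot reach \<nabla>.\<close>
      let ?T = "insert \<sigma> T"
      have sub_T: "?T \<subseteq> insert \<sigma> Ch" using T(1) by simp
      then have "subset.chain ?P ?T" using ch' unfolding subset_chain_def by (meson subset_iff subset_trans)
      then have "\<Union>?T \<in> ?T" using T(2) by (intro Union_in_chain) auto
      then have "\<Union>?T \<in> insert \<sigma> Ch" using sub_T by (rule subsetD[rotated])
      then have m': "\<Union>?T \<in> ?P" using ch' unfolding subset_chain_def by (meson subsetD)
      then have "cSup ar A T \<subseteq> \<Union>?T" by (intro cSup_least) auto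
      then have "\<Union>?T = \<nabla>" using T(3) m' by (intro nabla_eqI) auto
      then show False using m' by simp
    qed
    then show "\<exists>U\<in>?P. \<forall>X\<in>Ch. X \<subseteq> U"
      using U cSup_upper[of _ "insert \<sigma> Ch" ar A] by (intro bexI[of _ ?U]) auto
  qed
  then obtain M where M: "M \<in> ?P" "\<forall>X\<in>?P. M \<subseteq> X \<longrightarrow> X = M" by blast
  then have "maximal_con ar A M" unfolding maximal_con_def by auto
  then show ?thesis using M by blast
qed

text \<open>If \<beta> is outside \<phi>, maximality gives
  \<open>\<beta> \<squnion> \<phi> = \<nabla>\<close>, and then the complement \<alpha> falls below
  \<phi>.\<close>

lemma maximal_con_BCon:
  assumes m: "maximal_con ar A \<phi>" and c: "complementary \<alpha> \<beta>"
  shows "\<alpha> \<subseteq> \<phi> \<or> \<beta> \<subseteq> \<phi>"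
proof (rule disjCI)
  have C: "\<phi> \<in> \<C>" "\<alpha> \<in> \<C>" "\<beta> \<in> \<C>" using m c unfolding maximal_con_def complementary_def by auto
  assume "\<not> \<beta> \<subseteq> \<phi>"
  then have "\<beta> \<squnion> \<phi> \<noteq> \<phi>" using cjoin_upper(1)[of \<beta> ar A \<phi>] by auto
  then have "\<beta> \<squnion> \<phi> = \<nabla>"
    using m C cjoin_upper(2)[of \<phi> ar A \<beta>] unfolding maximal_con_def by blast
  then show "\<alpha> \<subseteq> \<phi>" using complementary_le[OF complementary_sym[OF c] C(1)] by simp
qed

end

section \<open>Congruences of quotients\<close>

lemma class_eq_iff:
  assumes \<theta>: "\<theta> \<in> Con ar A" and "x \<in> univ A" "y \<in> univ A"
  shows "\<theta> `` {x} = \<theta> `` {y} \<longleftrightarrow> (x, y) \<in> \<theta>"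
  using \<theta> eq_equiv_class_iff[of "univ A" \<theta> x y] assms(2,3) unfolding Con_def is_con_def by simp

lemma quot_univ: "univ (quot A \<theta>) = (\<lambda>x. \<theta> `` {x}) ` univ A"
  unfolding quot_def quotient_def by auto

text \<open>The operations of \<open>quot\<close> choose representatives by \<open>SOME\<close>;
  compatibility of \<theta> makes the choice irrelevant.\<close>

lemma quot_ops:
  assumes \<theta>: "\<theta> \<in> Con ar A" and xs: "set xs \<subseteq> univ A" "length xs = ar f"
  shows "ops (quot A \<theta>) f (map (\<lambda>x. \<theta> `` {x}) xs) = \<theta> `` {ops A f xs}"
proof -
  let ?ys = "map (\<lambda>x. SOME y. y \<in> \<theta> `` {x}) xs"
  have "(SOME y. y \<in> \<theta> `` {x}) \<in> \<theta> `` {x}" if "x \<in> univ A" for x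
    using ConD(2)[OF \<theta> that] by (intro someI) auto
  then have "list_all2 (\<lambda>x y. (x, y) \<in> \<theta>) xs ?ys"
    using xs(1) by (simp add: list_all2_conv_all_nth subset_iff)
  then have "(ops A f xs, ops A f ?ys) \<in> \<theta>" by (rule ConD(5)[OF \<theta> xs(2)])
  then have "\<theta> `` {ops A f xs} = \<theta> `` {ops A f ?ys}"
    using class_eq_iff[OF \<theta>] Con_mem_univ[OF \<theta>] by metis
  then show ?thesis unfolding quot_def by (simp add: comp_def)
qed

lemma quot_alg:
  assumes alg: "is_alg ar A" and \<theta>: "\<theta> \<in> Con ar A"
  shows "is_alg ar (quot A \<theta>)"
  unfolding is_alg_def
proof (intro conjI allI impI)
  show "univ (quot A \<theta>) \<noteq> {}" using alg unfolding is_alg_def quot_univ by simp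
  fix f Xs assume "length Xs = ar f \<and> set Xs \<subseteq> univ (quot A \<theta>)"
  then have l: "length Xs = ar f" "set Xs \<subseteq> univ (quot A \<theta>)" by auto
  then have "Xs \<in> lists ((\<lambda>x. \<theta> `` {x}) ` univ A)" by (auto simp: quot_univ)
  then obtain xs where xs: "set xs \<subseteq> univ A" "Xs = map (\<lambda>x. \<theta> `` {x}) xs"
    unfolding lists_image by auto
  then have "ops A f xs \<in> univ A" using alg l unfolding is_alg_def by simp
  then show "ops (quot A \<theta>) f Xs \<in> univ (quot A \<theta>)"
    using quot_ops[OF \<theta> xs(1)] xs(2) l(1) by (simp add: quot_univ)
qed

lemma quot_con_iff:
  assumes \<theta>: "\<theta> \<in> Con ar A" and \<gamma>: "\<gamma> \<in> Con ar A" "\<theta> \<subseteq> \<gamma>" and xy: "x \<in> univ A" "y \<in> univ A"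
  shows "(\<theta> `` {x}, \<theta> `` {y}) \<in> quot_con \<theta> \<gamma> \<longleftrightarrow> (x, y) \<in> \<gamma>"
proof
  assume "(\<theta> `` {x}, \<theta> `` {y}) \<in> quot_con \<theta> \<gamma>"
  then obtain x' y' where e: "\<theta> `` {x} = \<theta> `` {x'}" "\<theta> `` {y} = \<theta> `` {y'}" and g: "(x', y') \<in> \<gamma>"
    unfolding quot_con_def by auto
  have "x' \<in> univ A" "y' \<in> univ A" using Con_mem_univ[OF \<gamma>(1) g] by auto
  then have "(x, x') \<in> \<gamma>" "(y, y') \<in> \<gamma>" using e class_eq_iff[OF \<theta>] xy \<gamma>(2) by blast+
  then show "(x, y) \<in> \<gamma>" using g ConD(3,4)[OF \<gamma>(1)] by blast
qed (auto simp: quot_con_def)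

lemma quot_con_Con:
  assumes \<theta>: "\<theta> \<in> Con ar A" and \<gamma>: "\<gamma> \<in> Con ar A" "\<theta> \<subseteq> \<gamma>"
  shows "quot_con \<theta> \<gamma> \<in> Con ar (quot A \<theta>)"
proof (rule ConI)
  note iff = quot_con_iff[OF \<theta> \<gamma>]
  have sub: "quot_con \<theta> \<gamma> \<subseteq> (\<lambda>x. \<theta> `` {x}) ` univ A \<times> (\<lambda>x. \<theta> `` {x}) ` univ A"
    unfolding quot_con_def using Con_mem_univ[OF \<gamma>(1)] by auto
  then show "quot_con \<theta> \<gamma> \<subseteq> univ (quot A \<theta>) \<times> univ (quot A \<theta>)" by (simp add: quot_univ)
  show "(X, X) \<in> quot_con \<theta> \<gamma>" if "X \<in> univ (quot A \<theta>)" for X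
    using that iff ConD(2)[OF \<gamma>(1)] by (auto simp: quot_univ)
  show "(Y, X) \<in> quot_con \<theta> \<gamma>" if "(X, Y) \<in> quot_con \<theta> \<gamma>" for X Y
    using that ConD(3)[OF \<gamma>(1)] unfolding quot_con_def by blast
  show "(X, Z) \<in> quot_con \<theta> \<gamma>" if XY: "(X, Y) \<in> quot_con \<theta> \<gamma>" and YZ: "(Y, Z) \<in> quot_con \<theta> \<gamma>" for X Y Z
  proof -
    have "X \<in> (\<lambda>x. \<theta> `` {x}) ` univ A" "Y \<in> (\<lambda>x. \<theta> `` {x}) ` univ A" "Z \<in> (\<lambda>x. \<theta> `` {x}) ` univ A"
      using sub XY YZ by blast+
    then obtain x y z where xyz: "x \<in> univ A" "y \<in> univ A" "z \<in> univ A"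
      "X = \<theta> `` {x}" "Y = \<theta> `` {y}" "Z = \<theta> `` {z}"
      by blast
    then have "(x, z) \<in> \<gamma>" using XY YZ iff ConD(4)[OF \<gamma>(1)] by blast
    then show ?thesis using xyz iff by simp
  qed
  fix f Xs Ys assume l: "length Xs = ar f" "list_all2 (\<lambda>X Y. (X, Y) \<in> quot_con \<theta> \<gamma>) Xs Ys"
  from l(2) have "\<exists>xs ys. set xs \<subseteq> univ A \<and> set ys \<subseteq> univ A \<and> Xs = map (\<lambda>x. \<theta> `` {x}) xs \<and>
      Ys = map (\<lambda>x. \<theta> `` {x}) ys \<and> list_all2 (\<lambda>x y. (x, y) \<in> \<gamma>) xs ys"
  proof (induction rule: list_all2_induct)
    case Nil
    then show ?case by simp
  next
    case (Cons X Xs Y Ys)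
    obtain x y where xy: "(x, y) \<in> \<gamma>" "X = \<theta> `` {x}" "Y = \<theta> `` {y}"
      using Cons(1) unfolding quot_con_def by auto
    obtain xs ys where xs: "set xs \<subseteq> univ A" "set ys \<subseteq> univ A" "Xs = map (\<lambda>x. \<theta> `` {x}) xs"
      "Ys = map (\<lambda>x. \<theta> `` {x}) ys" "list_all2 (\<lambda>x y. (x, y) \<in> \<gamma>) xs ys"
      using Cons.IH by blast
    show ?case
      using xy xs Con_mem_univ[OF \<gamma>(1) xy(1)]
      by (intro exI[of _ "x # xs"] exI[of _ "y # ys"]) simp
  qed
  then obtain xs ys where xs: "set xs \<subseteq> univ A" "set ys \<subseteq> univ A" "Xs = map (\<lambda>x. \<theta> `` {x}) xs"
      "Ys = map (\<lambda>x. \<theta> `` {x}) ys" "list_all2 (\<lambda>x y. (x, y) \<in> \<gamma>) xs ys" by blast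
  then have len: "length xs = ar f" "length ys = ar f" using l list_all2_lengthD[OF l(2)] by auto
  then have "(ops A f xs, ops A f ys) \<in> \<gamma>" using xs(5) by (intro ConD(5)[OF \<gamma>(1)])
  then show "(ops (quot A \<theta>) f Xs, ops (quot A \<theta>) f Ys) \<in> quot_con \<theta> \<gamma>"
    using xs len quot_ops[OF \<theta>] unfolding quot_con_def by auto
qed

text \<open>Surjectivity in the correspondence theorem: \<gamma> is the pullback of \<beta> along
  the canonical projection.\<close>

lemma quot_con_surj:
  assumes alg: "is_alg ar A" and \<theta>: "\<theta> \<in> Con ar A" and \<beta>: "\<beta> \<in> Con ar (quot A \<theta>)"
  shows "\<exists>\<gamma>\<in>Con ar A. \<theta> \<subseteq> \<gamma> \<and> \<beta> = quot_con \<theta> \<gamma>"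
proof -
  let ?c = "\<lambda>x. \<theta> `` {x}"
  let ?g = "{(x, y). x \<in> univ A \<and> y \<in> univ A \<and> (?c x, ?c y) \<in> \<beta>}"
  have "?g \<in> Con ar A"
  proof (rule ConI)
    show "(x, x) \<in> ?g" if "x \<in> univ A" for x
      using that ConD(2)[OF \<beta>] by (auto simp: quot_univ)
    show "(y, x) \<in> ?g" if "(x, y) \<in> ?g" for x y
      using that ConD(3)[OF \<beta>] by simp
    show "(x, z) \<in> ?g" if "(x, y) \<in> ?g" "(y, z) \<in> ?g" for x y z
      using that ConD(4)[OF \<beta>, of "?c x" "?c y" "?c z"] by simp
    fix f xs ys assume l: "length xs = ar f" "list_all2 (\<lambda>x y. (x, y) \<in> ?g) xs ys"
    have "list_all2 (\<lambda>x y. (x, y) \<in> \<beta>) (map ?c xs) (map ?c ys)"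
      using l(2) by (auto simp: list_all2_map1 list_all2_map2 elim!: list_all2_mono)
    then have "(ops (quot A \<theta>) f (map ?c xs), ops (quot A \<theta>) f (map ?c ys)) \<in> \<beta>"
      using l(1) by (intro ConD(5)[OF \<beta>]) auto
    moreover have u: "set xs \<subseteq> univ A \<and> set ys \<subseteq> univ A" by (rule list_all2_fst_snd[OF l(2)]) auto
    moreover have "length ys = ar f" using l list_all2_lengthD[OF l(2)] by simp
    ultimately show "(ops A f xs, ops A f ys) \<in> ?g"
      using quot_ops[OF \<theta>] l(1) alg unfolding is_alg_def by simp
  qed auto
  moreover have "\<theta> \<subseteq> ?g"
  proof clarify
    fix x y assume xy: "(x, y) \<in> \<theta>"
    then have u: "x \<in> univ A" "y \<in> univ A" using Con_mem_univ[OF \<theta>] by auto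
    then have "?c x = ?c y" using class_eq_iff[OF \<theta>] xy by blast
    then show "x \<in> univ A \<and> y \<in> univ A \<and> (?c x, ?c y) \<in> \<beta>"
      using u ConD(2)[OF \<beta>] by (auto simp: quot_univ)
  qed
  moreover have "\<beta> = quot_con \<theta> ?g"
  proof
    show "\<beta> \<subseteq> quot_con \<theta> ?g"
    proof clarify
      fix X Y assume XY: "(X, Y) \<in> \<beta>"
      then have "X \<in> ?c ` univ A" "Y \<in> ?c ` univ A" using Con_mem_univ[OF \<beta>] by (auto simp: quot_univ)
      then show "(X, Y) \<in> quot_con \<theta> ?g" using XY unfolding quot_con_def by blast
    qed
    show "quot_con \<theta> ?g \<subseteq> \<beta>" unfolding quot_con_def by auto
  qed
  ultimately show ?thesis by blast
qed

lemma quot_con_mono_iff: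
  assumes \<theta>: "\<theta> \<in> Con ar A" and \<gamma>: "\<gamma> \<in> Con ar A" "\<theta> \<subseteq> \<gamma>" and \<gamma>': "\<gamma>' \<in> Con ar A" "\<theta> \<subseteq> \<gamma>'"
  shows "quot_con \<theta> \<gamma> \<subseteq> quot_con \<theta> \<gamma>' \<longleftrightarrow> \<gamma> \<subseteq> \<gamma>'"
proof
  assume le: "quot_con \<theta> \<gamma> \<subseteq> quot_con \<theta> \<gamma>'"
  show "\<gamma> \<subseteq> \<gamma>'"
  proof clarify
    fix x y assume xy: "(x, y) \<in> \<gamma>"
    then have u: "x \<in> univ A" "y \<in> univ A" using Con_mem_univ[OF \<gamma>(1)] by auto
    have "(\<theta> `` {x}, \<theta> `` {y}) \<in> quot_con \<theta> \<gamma>'" using le xy unfolding quot_con_def by blast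
    then show "(x, y) \<in> \<gamma>'" using quot_con_iff[OF \<theta> \<gamma>' u] by simp
  qed
qed (auto simp: quot_con_def)

lemma quot_con_eq_iff:
  assumes "\<theta> \<in> Con ar A" "\<gamma> \<in> Con ar A" "\<theta> \<subseteq> \<gamma>" "\<gamma>' \<in> Con ar A" "\<theta> \<subseteq> \<gamma>'"
  shows "quot_con \<theta> \<gamma> = quot_con \<theta> \<gamma>' \<longleftrightarrow> \<gamma> = \<gamma>'"
  using quot_con_mono_iff[OF assms] quot_con_mono_iff[OF assms(1,4,5,2,3)] by auto

lemma quot_con_Int:
  assumes \<theta>: "\<theta> \<in> Con ar A" and \<gamma>: "\<gamma> \<in> Con ar A" "\<theta> \<subseteq> \<gamma>" and \<gamma>': "\<gamma>' \<in> Con ar A" "\<theta> \<subseteq> \<gamma>'"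
  shows "quot_con \<theta> \<gamma> \<inter> quot_con \<theta> \<gamma>' = quot_con \<theta> (\<gamma> \<inter> \<gamma>')"
proof
  show "quot_con \<theta> \<gamma> \<inter> quot_con \<theta> \<gamma>' \<subseteq> quot_con \<theta> (\<gamma> \<inter> \<gamma>')"
  proof clarify
    fix X Y assume XY: "(X, Y) \<in> quot_con \<theta> \<gamma>" "(X, Y) \<in> quot_con \<theta> \<gamma>'"
    then obtain x y where xy: "(x, y) \<in> \<gamma>" "X = \<theta> `` {x}" "Y = \<theta> `` {y}"
      unfolding quot_con_def by blast
    then have u: "x \<in> univ A" "y \<in> univ A" using Con_mem_univ[OF \<gamma>(1)] by auto
    then have "(x, y) \<in> \<gamma>'" using XY(2) xy quot_con_iff[OF \<theta> \<gamma>' u] by simp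
    then show "(X, Y) \<in> quot_con \<theta> (\<gamma> \<inter> \<gamma>')" using xy unfolding quot_con_def by blast
  qed
qed (auto simp: quot_con_def)

lemma quot_con_self: "\<theta> \<in> Con ar A \<Longrightarrow> quot_con \<theta> \<theta> = Delta (quot A \<theta>)"
proof -
  assume \<theta>: "\<theta> \<in> Con ar A"
  have "\<theta> `` {x} = \<theta> `` {y} \<and> y \<in> univ A" if "(x, y) \<in> \<theta>" for x y
    using that class_eq_iff[OF \<theta>] Con_mem_univ[OF \<theta>] by blast
  then have "quot_con \<theta> \<theta> \<subseteq> Delta (quot A \<theta>)"
    unfolding quot_con_def Delta_def quot_univ by auto
  moreover have "Delta (quot A \<theta>) \<subseteq> quot_con \<theta> \<theta>"
    unfolding quot_con_def Delta_def quot_univ using ConD(2)[OF \<theta>] by fastforce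
  ultimately show ?thesis by blast
qed

lemma quot_con_Nabla: "quot_con \<theta> (Nabla A) = Nabla (quot A \<theta>)"
  unfolding quot_con_def Nabla_def quot_univ by auto

text \<open>This replaces the generated congruence by a condition on the order alone, which
  transfers along the correspondence with the congruences of a quotient.\<close>

lemma cjoin_eq_Nabla_iff:
  assumes "is_alg ar A" "\<alpha> \<in> Con ar A" "\<beta> \<in> Con ar A"
  shows "cjoin ar A \<alpha> \<beta> = Nabla A \<longleftrightarrow> (\<forall>\<gamma>\<in>Con ar A. \<alpha> \<subseteq> \<gamma> \<and> \<beta> \<subseteq> \<gamma> \<longrightarrow> \<gamma> = Nabla A)"
  using cjoin_Con[OF assms] cjoin_upper[of \<alpha> ar A \<beta>] cjoin_upper(2)[of \<beta> ar A \<alpha>]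
    cjoin_least[of _ ar A \<alpha> \<beta>] Con_subset_Nabla[of _ ar A] by (metis subset_antisym)

lemma quot_cjoin_eq_Nabla_iff:
  assumes alg: "is_alg ar A" and \<theta>: "\<theta> \<in> Con ar A"
    and \<gamma>: "\<gamma> \<in> Con ar A" "\<theta> \<subseteq> \<gamma>" and \<gamma>': "\<gamma>' \<in> Con ar A" "\<theta> \<subseteq> \<gamma>'"
  shows "cjoin ar (quot A \<theta>) (quot_con \<theta> \<gamma>) (quot_con \<theta> \<gamma>') = Nabla (quot A \<theta>) \<longleftrightarrow>
    cjoin ar A \<gamma> \<gamma>' = Nabla A"
proof -
  have N: "Nabla A \<in> Con ar A" "\<theta> \<subseteq> Nabla A"
    using Nabla_Con[OF alg] Con_subset_Nabla[OF \<theta>] by auto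
  have le: "quot_con \<theta> \<gamma> \<subseteq> quot_con \<theta> \<delta> \<longleftrightarrow> \<gamma> \<subseteq> \<delta>" "quot_con \<theta> \<gamma>' \<subseteq> quot_con \<theta> \<delta> \<longleftrightarrow> \<gamma>' \<subseteq> \<delta>"
    "quot_con \<theta> \<delta> = Nabla (quot A \<theta>) \<longleftrightarrow> \<delta> = Nabla A"
    if "\<delta> \<in> Con ar A" "\<theta> \<subseteq> \<delta>" for \<delta>
    using quot_con_mono_iff[OF \<theta> \<gamma> that] quot_con_mono_iff[OF \<theta> \<gamma>' that]
      quot_con_eq_iff[OF \<theta> that N] by (simp_all add: quot_con_Nabla)
  have "cjoin ar (quot A \<theta>) (quot_con \<theta> \<gamma>) (quot_con \<theta> \<gamma>') = Nabla (quot A \<theta>) \<longleftrightarrow>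
     (\<forall>\<beta>\<in>Con ar (quot A \<theta>). quot_con \<theta> \<gamma> \<subseteq> \<beta> \<and> quot_con \<theta> \<gamma>' \<subseteq> \<beta> \<longrightarrow> \<beta> = Nabla (quot A \<theta>))"
    by (rule cjoin_eq_Nabla_iff[OF quot_alg[OF alg \<theta>] quot_con_Con[OF \<theta> \<gamma>] quot_con_Con[OF \<theta> \<gamma>']])
  also have "\<dots> \<longleftrightarrow> (\<forall>\<delta>\<in>Con ar A. \<theta> \<subseteq> \<delta> \<longrightarrow> \<gamma> \<subseteq> \<delta> \<and> \<gamma>' \<subseteq> \<delta> \<longrightarrow> \<delta> = Nabla A)" (is "?l \<longleftrightarrow> ?r")
  proof
    assume l: ?l
    show ?r
    proof (intro ballI impI)
      fix \<delta> assume \<delta>: "\<delta> \<in> Con ar A" "\<theta> \<subseteq> \<delta>" "\<gamma> \<subseteq> \<delta> \<and> \<gamma>' \<subseteq> \<delta>"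
      have "quot_con \<theta> \<delta> = Nabla (quot A \<theta>)"
        using bspec[OF l quot_con_Con[OF \<theta> \<delta>(1,2)]] le[OF \<delta>(1,2)] \<delta>(3) by simp
      then show "\<delta> = Nabla A" using le(3)[OF \<delta>(1,2)] by simp
    qed
  next
    assume r: ?r
    show ?l
    proof (intro ballI impI)
      fix \<beta> assume \<beta>: "\<beta> \<in> Con ar (quot A \<theta>)" "quot_con \<theta> \<gamma> \<subseteq> \<beta> \<and> quot_con \<theta> \<gamma>' \<subseteq> \<beta>"
      obtain \<delta> where \<delta>: "\<delta> \<in> Con ar A" "\<theta> \<subseteq> \<delta>" "\<beta> = quot_con \<theta> \<delta>"
        using quot_con_surj[OF alg \<theta> \<beta>(1)] by blast
      then have "\<delta> = Nabla A" using bspec[OF r \<delta>(1)] \<beta>(2) le[OF \<delta>(1,2)] by simp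
      then show "\<beta> = Nabla (quot A \<theta>)" using \<delta>(3) quot_con_Nabla by blast
    qed
  qed
  also have "\<dots> \<longleftrightarrow> cjoin ar A \<gamma> \<gamma>' = Nabla A"
    using cjoin_eq_Nabla_iff[OF alg \<gamma>(1) \<gamma>'(1)] \<gamma>(2) by auto
  finally show ?thesis .
qed

section \<open>Lifting complemented congruences\<close>

context semidegenerate_modular
begin

text \<open>By the correspondence theorem these pairs stand for the complementary pairs in the
  congruence lattice of \<open>quot A \<theta>\<close>.\<close>

definition complementary_over :: "'a rel \<Rightarrow> 'a rel \<Rightarrow> 'a rel \<Rightarrow> bool" where
  "complementary_over \<theta> \<phi> \<psi> \<longleftrightarrow>
     \<phi> \<in> \<C> \<and> \<psi> \<in> \<C> \<and> \<theta> \<subseteq> \<phi> \<and> \<theta> \<subseteq> \<psi> \<and> \<phi> \<inter> \<psi> = \<theta> \<and> \<phi> \<squnion> \<psi> = \<nabla>"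

lemma BCon_quot:
  assumes \<theta>: "\<theta> \<in> \<C>"
  shows "BCon ar (quot A \<theta>) = quot_con \<theta> ` {\<phi>. \<exists>\<psi>. complementary_over \<theta> \<phi> \<psi>}"
proof -
  have iff: "quot_con \<theta> \<phi> \<inter> quot_con \<theta> \<psi> = Delta (quot A \<theta>) \<and>
      cjoin ar (quot A \<theta>) (quot_con \<theta> \<phi>) (quot_con \<theta> \<psi>) = Nabla (quot A \<theta>) \<longleftrightarrow>
      complementary_over \<theta> \<phi> \<psi>"
    if C: "\<phi> \<in> \<C>" "\<theta> \<subseteq> \<phi>" "\<psi> \<in> \<C>" "\<theta> \<subseteq> \<psi>" for \<phi> \<psi>
  proof -
    have "quot_con \<theta> \<phi> \<inter> quot_con \<theta> \<psi> = Delta (quot A \<theta>) \<longleftrightarrow> \<phi> \<inter> \<psi> = \<theta>"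
      using C quot_con_Int[OF \<theta> C] quot_con_self[OF \<theta>] quot_con_eq_iff[OF \<theta>, of "\<phi> \<inter> \<psi>" \<theta>] \<theta> by auto
    then show ?thesis
      unfolding complementary_over_def using quot_cjoin_eq_Nabla_iff[OF alg \<theta> C] C by simp
  qed
  show ?thesis
  proof (intro set_eqI iffI)
    fix \<beta> assume "\<beta> \<in> BCon ar (quot A \<theta>)"
    then obtain \<beta>' where b: "\<beta> \<in> Con ar (quot A \<theta>)" "\<beta>' \<in> Con ar (quot A \<theta>)"
      "\<beta> \<inter> \<beta>' = Delta (quot A \<theta>)" "cjoin ar (quot A \<theta>) \<beta> \<beta>' = Nabla (quot A \<theta>)"
      unfolding BCon_def by blast
    obtain \<phi> where \<phi>: "\<phi> \<in> \<C>" "\<theta> \<subseteq> \<phi>" "\<beta> = quot_con \<theta> \<phi>"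
      using quot_con_surj[OF alg \<theta> b(1)] by blast
    obtain \<psi> where \<psi>: "\<psi> \<in> \<C>" "\<theta> \<subseteq> \<psi>" "\<beta>' = quot_con \<theta> \<psi>"
      using quot_con_surj[OF alg \<theta> b(2)] by blast
    have "complementary_over \<theta> \<phi> \<psi>"
      using iff[OF \<phi>(1,2) \<psi>(1,2)] b(3,4) \<phi>(3) \<psi>(3) by simp
    then show "\<beta> \<in> quot_con \<theta> ` {\<phi>. \<exists>\<psi>. complementary_over \<theta> \<phi> \<psi>}" using \<phi>(3) by blast
  next
    fix \<beta> assume "\<beta> \<in> quot_con \<theta> ` {\<phi>. \<exists>\<psi>. complementary_over \<theta> \<phi> \<psi>}"
    then obtain \<phi> \<psi> where c: "complementary_over \<theta> \<phi> \<psi>" "\<beta> = quot_con \<theta> \<phi>" by blast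
    then have C: "\<phi> \<in> \<C>" "\<theta> \<subseteq> \<phi>" "\<psi> \<in> \<C>" "\<theta> \<subseteq> \<psi>" unfolding complementary_over_def by auto
    show "\<beta> \<in> BCon ar (quot A \<theta>)"
      unfolding BCon_def using c iff[OF C] quot_con_Con[OF \<theta> C(1,2)] quot_con_Con[OF \<theta> C(3,4)]
      by blast
  qed
qed

lemma CBLP_iff:
  assumes \<theta>: "\<theta> \<in> \<C>"
  shows "CBLP ar A \<theta> \<longleftrightarrow>
    (\<forall>\<phi> \<psi>. complementary_over \<theta> \<phi> \<psi> \<longrightarrow> (\<exists>\<alpha>\<in>BCon ar A. \<alpha> \<squnion> \<theta> = \<phi>))"
proof -
  have iff: "quot_con \<theta> (\<alpha> \<squnion> \<theta>) = quot_con \<theta> \<phi> \<longleftrightarrow> \<alpha> \<squnion> \<theta> = \<phi>"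
    if "complementary_over \<theta> \<phi> \<psi>" "\<alpha> \<in> BCon ar A" for \<alpha> \<phi> \<psi>
    using that \<theta> cjoin_upper(2)[of \<theta> ar A \<alpha>] unfolding complementary_over_def
    by (intro quot_con_eq_iff[OF \<theta>]) auto
  have ex_iff: "(\<exists>\<alpha>\<in>BCon ar A. quot_con \<theta> (\<alpha> \<squnion> \<theta>) = quot_con \<theta> \<phi>) \<longleftrightarrow> (\<exists>\<alpha>\<in>BCon ar A. \<alpha> \<squnion> \<theta> = \<phi>)"
    if "complementary_over \<theta> \<phi> \<psi>" for \<phi> \<psi>
    using iff[OF that] by (intro bex_cong) auto
  have "CBLP ar A \<theta> \<longleftrightarrow> (\<forall>\<phi> \<psi>. complementary_over \<theta> \<phi> \<psi> \<longrightarrow>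
      (\<exists>\<alpha>\<in>BCon ar A. quot_con \<theta> (\<alpha> \<squnion> \<theta>) = quot_con \<theta> \<phi>))"
    unfolding CBLP_def BCon_quot[OF \<theta>] by auto
  also have "\<dots> \<longleftrightarrow> (\<forall>\<phi> \<psi>. complementary_over \<theta> \<phi> \<psi> \<longrightarrow> (\<exists>\<alpha>\<in>BCon ar A. \<alpha> \<squnion> \<theta> = \<phi>))"
    by (intro all_cong1 imp_cong refl ex_iff)
  finally show ?thesis .
qed

text \<open>\<theta> and \<nabla> always occur in such pairs, so a bound of two leaves no room for a
  third congruence. Finiteness stands beside \<open>card\<close> because an infinite set has
  \<open>card\<close> 0.\<close>

lemma card_BCon_quot_iff:
  assumes \<theta>: "\<theta> \<in> \<C>"
  shows "finite (BCon ar (quot A \<theta>)) \<and> card (BCon ar (quot A \<theta>)) \<le> 2 \<longleftrightarrow>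
    (\<forall>\<phi> \<psi>. complementary_over \<theta> \<phi> \<psi> \<longrightarrow> \<phi> = \<theta> \<or> \<phi> = \<nabla>)"
proof -
  let ?Y = "{\<phi>. \<exists>\<psi>. complementary_over \<theta> \<phi> \<psi>}"
  have le: "\<theta> \<subseteq> \<nabla>" using Con_subset_Nabla[OF \<theta>] .
  have "\<theta> \<squnion> \<nabla> = \<nabla>" using cjoin_upper(2)[of \<nabla> ar A \<theta>] \<theta> by (intro nabla_eqI) auto
  then have c: "complementary_over \<theta> \<theta> \<nabla>" "complementary_over \<theta> \<nabla> \<theta>"
    unfolding complementary_over_def using \<theta> le cjoin_commute[of ar A] by auto
  have "inj_on (quot_con \<theta>) ?Y"
    using quot_con_eq_iff[OF \<theta>] unfolding inj_on_def complementary_over_def by blast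
  then have eq: "finite (BCon ar (quot A \<theta>)) \<and> card (BCon ar (quot A \<theta>)) \<le> 2 \<longleftrightarrow> finite ?Y \<and> card ?Y \<le> 2"
    unfolding BCon_quot[OF \<theta>] by (simp add: card_image finite_image_iff)
  show ?thesis unfolding eq
  proof
    assume Y: "finite ?Y \<and> card ?Y \<le> 2"
    show "\<forall>\<phi> \<psi>. complementary_over \<theta> \<phi> \<psi> \<longrightarrow> \<phi> = \<theta> \<or> \<phi> = \<nabla>"
    proof (intro allI impI, rule ccontr)
      fix \<phi> \<psi> assume cp: "complementary_over \<theta> \<phi> \<psi>" and ne: "\<not> (\<phi> = \<theta> \<or> \<phi> = \<nabla>)"
      then have "\<theta> \<noteq> \<nabla>" using Con_subset_Nabla[of \<phi> ar A] unfolding complementary_over_def by auto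
      moreover have "\<theta> \<noteq> \<phi>" "\<nabla> \<noteq> \<phi>" using ne by blast+
      ultimately have "card {\<theta>, \<nabla>, \<phi>} = 3" by simp
      moreover have "card {\<theta>, \<nabla>, \<phi>} \<le> card ?Y" using Y c cp by (intro card_mono) auto
      ultimately show False using Y by simp
    qed
  next
    assume "\<forall>\<phi> \<psi>. complementary_over \<theta> \<phi> \<psi> \<longrightarrow> \<phi> = \<theta> \<or> \<phi> = \<nabla>"
    then have sub: "?Y \<subseteq> {\<theta>, \<nabla>}" by blast
    then have "card ?Y \<le> card {\<theta>, \<nabla>}" by (intro card_mono) auto
    also have "\<dots> \<le> 2" by (cases "\<theta> = \<nabla>") auto
    finally show "finite ?Y \<and> card ?Y \<le> 2" using finite_subset[OF sub] by simp
  qed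
qed

text \<open>When the commutator of the two joins is expanded by distributivity, every term is below
  \<theta>. The joins still cover \<nabla>, so their meet lies below their commutator and equals
  \<theta>.\<close>

lemma complementary_over_join:
  assumes C: "\<theta> \<in> \<C>" "\<phi> \<in> \<C>" "\<psi> \<in> \<C>" and J: "\<phi> \<squnion> \<psi> = \<nabla>" and le: "\<phi> \<odot> \<psi> \<subseteq> \<theta>"
  shows "complementary_over \<theta> (\<theta> \<squnion> \<phi>) (\<theta> \<squnion> \<psi>)" "(\<theta> \<squnion> \<phi>) \<odot> (\<theta> \<squnion> \<psi>) = \<theta>"
proof -
  let ?f = "\<theta> \<squnion> \<phi>" and ?p = "\<theta> \<squnion> \<psi>"
  have F: "?f \<in> \<C>" "?p \<in> \<C>" using C by auto
  have up: "\<theta> \<subseteq> ?f" "\<theta> \<subseteq> ?p" "\<phi> \<subseteq> ?f" "\<psi> \<subseteq> ?p" by (rule cjoin_upper)+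
  have "\<phi> \<squnion> \<psi> \<subseteq> ?f \<squnion> ?p"
    using C F up cjoin_upper(1)[of ?f ar A ?p] cjoin_upper(2)[of ?p ar A ?f] by (intro cjoin_least) auto
  then have J': "?f \<squnion> ?p = \<nabla>" using J F by (intro nabla_eqI) auto
  have "?p \<odot> \<phi> \<subseteq> \<theta>"
    using C le comm_commute[of \<psi> \<phi>] comm_le_left[of \<theta> \<phi>] by (intro comm_join_le) auto
  then have "\<phi> \<odot> ?p \<subseteq> \<theta>" using C F comm_commute[of \<phi> ?p] by simp
  then have "?f \<odot> ?p \<subseteq> \<theta>" using C F comm_le_left[of \<theta> ?p] by (intro comm_join_le) auto
  moreover have "?f \<inter> ?p \<subseteq> ?f \<odot> ?p" using Int_le_comm[OF F J'] .
  ultimately show "?f \<odot> ?p = \<theta>" "complementary_over \<theta> ?f ?p"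
    unfolding complementary_over_def using F up J' by auto
qed

section \<open>CBLP as a lifting condition on covers\<close>

abbreviation lifts :: "'a rel \<Rightarrow> 'a rel \<Rightarrow> 'a rel \<Rightarrow> bool" where
  "lifts \<theta> \<phi> \<psi> \<equiv> \<exists>\<alpha>\<in>BCon ar A. \<alpha> \<subseteq> \<theta> \<squnion> \<phi> \<and> neg_con \<alpha> \<subseteq> \<theta> \<squnion> \<psi>"

lemma CBLP_imp_lifts:
  assumes \<theta>: "\<theta> \<in> \<C>" and cblp: "CBLP ar A \<theta>"
    and C: "\<phi> \<in> \<C>" "\<psi> \<in> \<C>" and J: "\<phi> \<squnion> \<psi> = \<nabla>" and le: "\<phi> \<odot> \<psi> \<subseteq> \<theta>"
  shows "lifts \<theta> \<phi> \<psi>"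
proof -
  have co: "complementary_over \<theta> (\<theta> \<squnion> \<phi>) (\<theta> \<squnion> \<psi>)" using complementary_over_join[OF \<theta> C J le] by simp
  then obtain \<alpha> where \<alpha>: "\<alpha> \<in> BCon ar A" "\<alpha> \<squnion> \<theta> = \<theta> \<squnion> \<phi>"
    using cblp CBLP_iff[OF \<theta>] by blast
  have "\<alpha> \<subseteq> \<theta> \<squnion> \<phi>" using \<alpha>(2) cjoin_upper(1)[of \<alpha> ar A \<theta>] by simp
  \<comment> \<open>\<alpha> and \<open>\<theta> \<squnion> \<psi>\<close> together cover \<nabla>,
    because \<open>\<alpha> \<squnion> \<theta>\<close> is already
    \<open>\<theta> \<squnion> \<phi>\<close>.\<close>
  moreover have "neg_con \<alpha> \<subseteq> \<theta> \<squnion> \<psi>"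
  proof (rule complementary_le[OF BCon_cneg[OF \<alpha>(1)]])
    let ?d = "\<alpha> \<squnion> (\<theta> \<squnion> \<psi>)"
    have d: "?d \<in> \<C>" using \<alpha> \<theta> C by auto
    have "\<alpha> \<subseteq> ?d" "\<theta> \<squnion> \<psi> \<subseteq> ?d" "\<theta> \<subseteq> \<theta> \<squnion> \<psi>" by (rule cjoin_upper)+
    then have "\<theta> \<squnion> \<phi> \<squnion> (\<theta> \<squnion> \<psi>) \<subseteq> ?d" using d \<alpha>(2)[symmetric] by (simp add: join_le_iff)
    then show "\<nabla> \<subseteq> ?d" using co unfolding complementary_over_def by simp
  qed (use \<theta> C in auto)
  ultimately show ?thesis using \<alpha>(1) by blast
qed

text \<open>A pair complementary over \<theta> covers \<nabla> and therefore has commutator exactly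
  \<theta>, so the hypothesis applies to the pair itself.\<close>

lemma lifts_imp_CBLP:
  assumes \<theta>: "\<theta> \<in> \<C>"
    and lifts: "\<And>\<phi> \<psi>. \<phi> \<in> \<C> \<Longrightarrow> \<psi> \<in> \<C> \<Longrightarrow> \<phi> \<squnion> \<psi> = \<nabla> \<Longrightarrow> \<phi> \<odot> \<psi> = \<theta> \<Longrightarrow> lifts \<theta> \<phi> \<psi>"
  shows "CBLP ar A \<theta>"
  unfolding CBLP_iff[OF \<theta>]
proof (intro allI impI)
  fix \<phi> \<psi> assume "complementary_over \<theta> \<phi> \<psi>"
  then have C: "\<phi> \<in> \<C>" "\<psi> \<in> \<C>" and le: "\<theta> \<subseteq> \<phi>" "\<theta> \<subseteq> \<psi>" and I: "\<phi> \<inter> \<psi> = \<theta>" and J: "\<phi> \<squnion> \<psi> = \<nabla>"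
    unfolding complementary_over_def by auto
  have comm: "\<phi> \<odot> \<psi> = \<theta>"
    using Int_le_comm[OF C J] comm_le_left[OF C] comm_le_right[OF C] I by blast
  then obtain \<alpha> where \<alpha>: "\<alpha> \<in> BCon ar A" "\<alpha> \<subseteq> \<theta> \<squnion> \<phi>" "neg_con \<alpha> \<subseteq> \<theta> \<squnion> \<psi>"
    using lifts[OF C J] by blast
  have "\<theta> \<squnion> \<phi> \<subseteq> \<phi>" "\<theta> \<squnion> \<psi> \<subseteq> \<psi>" using C le by (simp_all add: join_le_iff)
  then have a: "\<alpha> \<subseteq> \<phi>" "neg_con \<alpha> \<subseteq> \<psi>" using \<alpha> by auto
  have co: "complementary \<alpha> (neg_con \<alpha>)" using BCon_cneg[OF \<alpha>(1)] .
  then have N: "\<alpha> \<in> \<C>" "neg_con \<alpha> \<in> \<C>" "\<alpha> \<squnion> neg_con \<alpha> = \<nabla>" unfolding complementary_def by auto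
  \<comment> \<open>Tested on the cover by \<alpha> and \<open>neg_con \<alpha>\<close>; the second
    product lies in \<open>\<phi> \<odot> \<psi> = \<theta>\<close>.\<close>
  have "\<phi> \<subseteq> \<alpha> \<squnion> \<theta>"
  proof (rule le_of_cover[OF N(1,2) C(1) _ N(3)])
    show "\<phi> \<odot> \<alpha> \<subseteq> \<alpha> \<squnion> \<theta>" using comm_le_right[OF C(1) N(1)] cjoin_upper(1)[of \<alpha> ar A \<theta>] by blast
    have "\<phi> \<odot> neg_con \<alpha> \<subseteq> \<theta>" using comm_mono[OF C(1) N(2) C subset_refl a(2)] comm by simp
    then show "\<phi> \<odot> neg_con \<alpha> \<subseteq> \<alpha> \<squnion> \<theta>" using cjoin_upper(2)[of \<theta> ar A \<alpha>] by blast
  qed (use N \<theta> in auto)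
  moreover have "\<alpha> \<squnion> \<theta> \<subseteq> \<phi>" using C le a by (simp add: join_le_iff)
  ultimately show "\<exists>\<alpha>\<in>BCon ar A. \<alpha> \<squnion> \<theta> = \<phi>" using \<alpha>(1) by blast
qed

text \<open>Compactness replaces \<open>\<phi>\<^sup>\<diamond>\<close> by a single complemented \<open>\<alpha> \<subseteq> \<phi>\<close>; meeting one of the two factors
  with \<open>\<not>\<alpha>\<close> then removes \<open>\<alpha>\<close> from the bound on the commutator.\<close>
lemma lifts_imp_indecomposable:
  assumes \<theta>: "\<theta> \<in> \<C>"
    and lifts: "\<And>\<phi> \<psi>. \<phi> \<in> \<C> \<Longrightarrow> \<psi> \<in> \<C> \<Longrightarrow> \<phi> \<squnion> \<psi> = \<nabla> \<Longrightarrow> \<phi> \<odot> \<psi> \<subseteq> \<theta> \<Longrightarrow> lifts \<theta> \<phi> \<psi>"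
    and m: "maximal_con ar A \<phi>" and co: "complementary_over (\<theta> \<squnion> diamond ar A \<phi>) \<gamma> \<gamma>'"
  shows "\<gamma> = \<theta> \<squnion> diamond ar A \<phi> \<or> \<gamma> = \<nabla>"
proof -
  let ?s = "\<theta> \<squnion> diamond ar A \<phi>"
  have \<phi>: "\<phi> \<in> \<C>" using m unfolding maximal_con_def by simp
  have G: "\<gamma> \<in> \<C>" "\<gamma>' \<in> \<C>" "?s \<subseteq> \<gamma>" "?s \<subseteq> \<gamma>'" "\<gamma> \<inter> \<gamma>' = ?s" "\<gamma> \<squnion> \<gamma>' = \<nabla>"
    using co unfolding complementary_over_def by auto
  have s: "\<theta> \<subseteq> ?s" "diamond ar A \<phi> \<subseteq> ?s" by (rule cjoin_upper)+
  obtain \<kappa> \<kappa>' where K: "\<kappa> \<in> Kc ar A" "\<kappa>' \<in> Kc ar A" "\<kappa> \<subseteq> \<gamma>" "\<kappa>' \<subseteq> \<gamma>'" "\<kappa> \<squnion> \<kappa>' = \<nabla>"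
    using compact_cover[OF G(1,2,6)] by blast
  have KC: "\<kappa> \<in> \<C>" "\<kappa>' \<in> \<C>" using K(1,2) unfolding Kc_def by auto
  have "\<kappa> \<odot> \<kappa>' \<in> Kc ar A" using comm_compact K unfolding K_comm_closed_def by blast
  moreover have "\<kappa> \<odot> \<kappa>' \<subseteq> ?s" using comm_le_left[OF KC] comm_le_right[OF KC] K(3,4) G(5) by blast
  ultimately obtain \<alpha> where \<alpha>: "\<alpha> \<in> BCon ar A" "\<alpha> \<subseteq> \<phi>" "\<kappa> \<odot> \<kappa>' \<subseteq> \<theta> \<squnion> \<alpha>"
    using compact_le_join_diamond[OF _ \<theta> \<phi>] by blast
  obtain \<beta> where ab: "complementary \<alpha> \<beta>" using \<alpha>(1) BCon_iff by blast
  then have AB: "\<alpha> \<in> \<C>" "\<beta> \<in> \<C>" "\<alpha> \<squnion> \<beta> = \<nabla>" unfolding complementary_def by auto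
  \<comment> \<open>\<kappa>' is cut down to its part below \<beta>, the complement of \<alpha>, and
    \<alpha> joins the other factor. The pair still covers \<nabla>, but its commutator now drops
    below \<theta> itself.\<close>
  let ?f = "\<kappa> \<squnion> \<alpha>" and ?p = "\<kappa>' \<inter> \<beta>"
  have F: "?f \<in> \<C>" "?p \<in> \<C>" "?f \<squnion> ?p \<in> \<C>" using KC AB by auto
  have up: "\<kappa> \<subseteq> ?f" "\<alpha> \<subseteq> ?f" "?f \<subseteq> ?f \<squnion> ?p" "?p \<subseteq> ?f \<squnion> ?p" by (rule cjoin_upper)+
  have "\<kappa>' \<subseteq> ?f \<squnion> ?p"
    using comm_le_right[OF KC(2) AB(1)] comm_le_left[OF KC(2) AB(2)] comm_le_right[OF KC(2) AB(2)] up
    by (intro le_of_cover[OF AB(1,2) KC(2) F(3) AB(3)]) blast+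
  then have "\<kappa> \<squnion> \<kappa>' \<subseteq> ?f \<squnion> ?p" using F(3) up by (intro cjoin_least) auto
  then have J: "?f \<squnion> ?p = \<nabla>" using K(5) F(3) by (intro nabla_eqI) auto
  \<comment> \<open>Tested on the cover by \<alpha> and \<beta>: \<open>?p\<close> is below \<beta>,
    which annihilates \<alpha>, while multiplying \<open>\<theta> \<squnion> \<alpha>\<close> by
    \<beta> leaves only something below \<theta>.\<close>
  have "\<kappa> \<odot> ?p \<subseteq> \<theta>"
  proof (rule le_of_cover[OF AB(1,2) _ \<theta> AB(3)])
    have x: "\<kappa> \<odot> ?p \<in> \<C>" using KC F by auto
    have xp: "\<kappa> \<odot> ?p \<subseteq> ?p" using comm_le_right[OF KC(1) F(2)] .
    have "(\<kappa> \<odot> ?p) \<odot> \<alpha> \<subseteq> \<beta> \<odot> \<alpha>" using xp x AB by (intro comm_mono) auto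
    then show "(\<kappa> \<odot> ?p) \<odot> \<alpha> \<subseteq> \<theta>" using complementary_comm(2)[OF ab \<theta>] by blast
    have "\<kappa> \<odot> ?p \<subseteq> \<kappa> \<odot> \<kappa>'" using KC F by (intro comm_mono) auto
    then have "(\<kappa> \<odot> ?p) \<odot> \<beta> \<subseteq> (\<theta> \<squnion> \<alpha>) \<odot> \<beta>" using \<alpha> x AB \<theta> by (intro comm_mono) auto
    also have "\<dots> \<subseteq> \<theta>"
      using comm_le_left[OF \<theta> AB(2)] complementary_comm(1)[OF ab \<theta>] AB \<theta> by (intro comm_join_le) auto
    finally show "(\<kappa> \<odot> ?p) \<odot> \<beta> \<subseteq> \<theta>" .
  qed (use KC F in auto)
  moreover have "\<alpha> \<odot> ?p \<subseteq> \<theta>"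
    using comm_mono[of \<alpha> ?p \<alpha> \<beta>] complementary_comm(1)[OF ab \<theta>] AB F by blast
  ultimately have "?f \<odot> ?p \<subseteq> \<theta>" using KC AB F \<theta> by (intro comm_join_le) auto
  then obtain \<epsilon> where \<epsilon>: "\<epsilon> \<in> BCon ar A" "\<epsilon> \<subseteq> \<theta> \<squnion> ?f" "neg_con \<epsilon> \<subseteq> \<theta> \<squnion> ?p"
    using lifts[OF F(1,2) J] by blast
  have "\<alpha> \<subseteq> \<gamma>" using le_diamond[OF \<alpha>(1,2)] s G by blast
  then have "\<theta> \<squnion> ?f \<subseteq> \<gamma>" using s G K by (auto simp: join_le_iff)
  then have e: "\<epsilon> \<subseteq> \<gamma>" using \<epsilon> by blast
  have "\<theta> \<squnion> ?p \<subseteq> \<gamma>'" using s G K by (intro cjoin_least) auto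
  then have e': "neg_con \<epsilon> \<subseteq> \<gamma>'" using \<epsilon> by blast
  have ce: "complementary \<epsilon> (neg_con \<epsilon>)" using BCon_cneg[OF \<epsilon>(1)] .
  then have eJ: "\<epsilon> \<squnion> neg_con \<epsilon> = \<nabla>" unfolding complementary_def by simp
  \<comment> \<open>\<phi> contains \<epsilon> or its complement, and
    \<open>diamond ar A \<phi>\<close> carries that one into both \<gamma> and \<gamma>'. One of the
    two thus contains a complementary pair and is \<nabla>; if it is \<gamma>', then \<gamma> equals
    \<open>\<gamma> \<inter> \<gamma>'\<close>, the bottom.\<close>
  from maximal_con_BCon[OF m ce] show ?thesis
  proof
    assume "\<epsilon> \<subseteq> \<phi>"
    then have "\<epsilon> \<subseteq> \<gamma>'" using le_diamond[OF \<epsilon>(1)] s G by blast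
    then have "\<epsilon> \<squnion> neg_con \<epsilon> \<subseteq> \<gamma>'" using e' G(2) by (intro cjoin_least)
    then have "\<gamma>' = \<nabla>" using eJ G by (intro nabla_eqI) auto
    then show ?thesis using G(5) Con_subset_Nabla[OF G(1)] by auto
  next
    assume "neg_con \<epsilon> \<subseteq> \<phi>"
    then have "neg_con \<epsilon> \<subseteq> \<gamma>" using le_diamond[OF cneg_BCon[OF \<epsilon>(1)]] s G by blast
    then have "\<epsilon> \<squnion> neg_con \<epsilon> \<subseteq> \<gamma>" using e G(1) by (intro cjoin_least)
    then show ?thesis using eJ G by (auto dest!: nabla_eqI[rotated])
  qed
qed

lemma indecomposable_imp_lifts:
  assumes \<theta>: "\<theta> \<in> \<C>"
    and ind: "\<And>\<chi> \<gamma> \<gamma>'. maximal_con ar A \<chi> \<Longrightarrow> complementary_over (\<theta> \<squnion> diamond ar A \<chi>) \<gamma> \<gamma>' \<Longrightarrow>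
      \<gamma> = \<theta> \<squnion> diamond ar A \<chi> \<or> \<gamma> = \<nabla>"
    and C: "\<phi> \<in> \<C>" "\<psi> \<in> \<C>" and J: "\<phi> \<squnion> \<psi> = \<nabla>" and le: "\<phi> \<odot> \<psi> \<subseteq> \<theta>"
  shows "lifts \<theta> \<phi> \<psi>"
proof -
  let ?I = "\<lambda>\<phi>. {\<alpha> \<in> BCon ar A. \<alpha> \<subseteq> \<theta> \<squnion> \<phi>}"
  let ?S = "?I \<phi> \<union> ?I \<psi>"
  have S: "?S \<subseteq> \<C>" by auto
  have SC: "cSup ar A ?S \<in> \<C>" using S by (intro cSup_Con[OF alg])
  \<comment> \<open>Either the complemented congruences in \<open>?S\<close> join to \<nabla>, and
    finitely many of them assemble a lift, or they all lie in one maximal congruence.\<close>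
  show ?thesis
  proof (cases "cSup ar A ?S = \<nabla>")
    case True
    then obtain T where T: "T \<subseteq> ?S" "finite T" "\<nabla> \<subseteq> cSup ar A T"
      using KcD[OF Nabla_Kc S] by auto
    \<comment> \<open>Joined separately, the two kinds give complemented \<open>?a\<close> and
      \<open>?b\<close> that cover \<nabla>, so \<open>neg_con ?a\<close> falls below
      \<open>?b\<close>.\<close>
    let ?a = "cSup ar A (T \<inter> ?I \<phi>)" and ?b = "cSup ar A (T \<inter> ?I \<psi>)"
    have B: "?a \<in> BCon ar A" "?b \<in> BCon ar A" using T(2) by (auto intro!: finite_cSup_BCon)
    have a: "?a \<subseteq> \<theta> \<squnion> \<phi>" by (rule cSup_least) (use \<theta> C in auto)
    have b: "?b \<subseteq> \<theta> \<squnion> \<psi>" by (rule cSup_least) (use \<theta> C in auto)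
    have "cSup ar A T \<subseteq> ?a \<squnion> ?b"
    proof (rule cSup_least)
      fix \<beta> assume "\<beta> \<in> T"
      then have "\<beta> \<in> T \<inter> ?I \<phi> \<or> \<beta> \<in> T \<inter> ?I \<psi>" using T(1) by blast
      then have "\<beta> \<subseteq> ?a \<or> \<beta> \<subseteq> ?b"
        using cSup_upper[of \<beta> "T \<inter> ?I \<phi>" ar A] cSup_upper[of \<beta> "T \<inter> ?I \<psi>" ar A] by blast
      then show "\<beta> \<subseteq> ?a \<squnion> ?b" using cjoin_upper(1)[of ?a ar A ?b] cjoin_upper(2)[of ?b ar A ?a] by blast
    qed (use B in auto)
    then have "neg_con ?a \<subseteq> ?b"
      using T(3) B by (intro complementary_le[OF BCon_cneg[OF B(1)]]) auto
    then show ?thesis using B a b by blast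
  next
    case False
    then obtain \<chi> where m: "maximal_con ar A \<chi>" and \<chi>S: "cSup ar A ?S \<subseteq> \<chi>"
      using maximal_con_exists[OF SC] by blast
    have \<chi>: "\<chi> \<in> \<C>" "\<chi> \<noteq> \<nabla>" using m unfolding maximal_con_def by auto
    let ?s = "\<theta> \<squnion> diamond ar A \<chi>"
    have s: "?s \<in> \<C>" "\<theta> \<subseteq> ?s" using \<theta> cjoin_upper(1)[of \<theta> ar A "diamond ar A \<chi>"] by auto
    have I: "\<alpha> \<subseteq> \<chi>" if "\<alpha> \<in> ?S" for \<alpha> using \<chi>S cSup_upper[OF that, of ar A] by blast
    \<comment> \<open>\<xi> will be \<phi> and then \<psi>. Compactness yields one complemented
      \<alpha> below \<chi> whose complement is below \<open>\<theta> \<squnion> \<xi>\<close>,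
      hence in \<open>?S\<close> and below \<chi> too; so \<chi> would be \<nabla>.\<close>
    have no: "?s \<squnion> \<xi> \<noteq> \<nabla>" if \<xi>: "\<xi> \<in> \<C>" "?I \<xi> \<subseteq> ?S" for \<xi>
    proof
      assume n: "?s \<squnion> \<xi> = \<nabla>"
      let ?t = "\<theta> \<squnion> \<xi>"
      have t: "?t \<in> \<C>" "?t \<squnion> diamond ar A \<chi> \<in> \<C>" using \<theta> \<xi> by auto
      have "\<theta> \<subseteq> ?t" "\<xi> \<subseteq> ?t" "?t \<subseteq> ?t \<squnion> diamond ar A \<chi>" "diamond ar A \<chi> \<subseteq> ?t \<squnion> diamond ar A \<chi>"
        by (rule cjoin_upper)+
      then have "?s \<squnion> \<xi> \<subseteq> ?t \<squnion> diamond ar A \<chi>" using t(2) by (simp add: join_le_iff)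
      then obtain \<alpha> where \<alpha>: "\<alpha> \<in> BCon ar A" "\<alpha> \<subseteq> \<chi>" "\<nabla> \<subseteq> ?t \<squnion> \<alpha>"
        using compact_le_join_diamond[OF Nabla_Kc t(1) \<chi>(1)] n by auto
      have co: "complementary \<alpha> (neg_con \<alpha>)" using BCon_cneg[OF \<alpha>(1)] .
      then have "neg_con \<alpha> \<subseteq> ?t"
        using \<alpha>(3) t cjoin_commute[of ar A \<alpha> ?t] by (intro complementary_le[OF co]) auto
      then have "neg_con \<alpha> \<in> ?S" using cneg_BCon[OF \<alpha>(1)] \<xi>(2) by blast
      then have "\<alpha> \<squnion> neg_con \<alpha> \<subseteq> \<chi>" using I \<alpha>(2) \<chi>(1) by (intro cjoin_least) auto
      then have "\<chi> = \<nabla>" using co \<chi>(1) unfolding complementary_def by (intro nabla_eqI) auto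
      then show False using \<chi>(2) by simp
    qed
    \<comment> \<open>\<open>?s \<squnion> \<phi>\<close> must be \<open>?s\<close> or \<nabla>, and
      \<open>no\<close> excludes \<nabla>. So \<phi> is below \<open>?s\<close>, and \<psi> alone
      would have to complete \<open>?s\<close> to \<nabla>, which \<open>no\<close> excludes as
      well.\<close>
    have "complementary_over ?s (?s \<squnion> \<phi>) (?s \<squnion> \<psi>)"
      using complementary_over_join(1)[OF s(1) C J] le s(2) by blast
    then have "?s \<squnion> \<phi> = ?s" using ind[OF m] no[OF C(1)] by blast
    then have "\<phi> \<subseteq> ?s" using cjoin_upper(2)[of \<phi> ar A ?s] by simp
    then have "\<phi> \<squnion> \<psi> \<subseteq> ?s \<squnion> \<psi>"
      using s C cjoin_upper(1)[of ?s ar A \<psi>] cjoin_upper(2)[of \<psi> ar A ?s] by (intro cjoin_least) auto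
    then have "?s \<squnion> \<psi> = \<nabla>" using J s C by (intro nabla_eqI) auto
    then show ?thesis using no[OF C(2)] by blast
  qed
qed

end

section \<open>Equivalence of the four conditions\<close>

theorem theorem6p3:
  fixes ar :: "'f \<Rightarrow> nat"
    and Sig :: "(('f, nat) trm \<times> ('f, nat) trm) set"
    and A :: "('a, 'f) alg"
    and \<theta> :: "'a rel"
  assumes fin_sig: "finite (UNIV :: 'f set)"
    and V1: "\<forall>B :: ('a, 'f) alg. var_hyp ar Sig B"
    and V2: "\<forall>B :: ('a set, 'f) alg. var_hyp ar Sig B"
    and V3: "\<forall>B :: ('a \<times> 'a, 'f) alg. var_hyp ar Sig B"
    and V4: "\<forall>B :: ('a set set, 'f) alg. var_hyp ar Sig B"
    and A_in: "in_var ar Sig A"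
    and theta: "\<theta> \<in> Con ar A"
  shows "(CBLP ar A \<theta> \<longleftrightarrow>
            (\<forall>\<phi> \<in> Con ar A. \<forall>\<psi> \<in> Con ar A.
               cjoin ar A \<phi> \<psi> = Nabla A \<and> comm ar A \<phi> \<psi> \<subseteq> \<theta> \<longrightarrow>
               (\<exists>\<alpha> \<in> BCon ar A. \<alpha> \<subseteq> cjoin ar A \<theta> \<phi> \<and> cneg ar A \<alpha> \<subseteq> cjoin ar A \<theta> \<psi>)))
       \<and> ((\<forall>\<phi> \<in> Con ar A. \<forall>\<psi> \<in> Con ar A.
               cjoin ar A \<phi> \<psi> = Nabla A \<and> comm ar A \<phi> \<psi> \<subseteq> \<theta> \<longrightarrow>
               (\<exists>\<alpha> \<in> BCon ar A. \<alpha> \<subseteq> cjoin ar A \<theta> \<phi> \<and> cneg ar A \<alpha> \<subseteq> cjoin ar A \<theta> \<psi>))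
          \<longleftrightarrow>
            (\<forall>\<phi> \<in> Con ar A. \<forall>\<psi> \<in> Con ar A.
               cjoin ar A \<phi> \<psi> = Nabla A \<and> comm ar A \<phi> \<psi> = \<theta> \<longrightarrow>
               (\<exists>\<alpha> \<in> BCon ar A. \<alpha> \<subseteq> cjoin ar A \<theta> \<phi> \<and> cneg ar A \<alpha> \<subseteq> cjoin ar A \<theta> \<psi>)))
       \<and> (CBLP ar A \<theta> \<longleftrightarrow>
            (\<forall>\<phi>. maximal_con ar A \<phi> \<longrightarrow>
               finite (BCon ar (quot A (cjoin ar A \<theta> (diamond ar A \<phi>)))) \<and>
               card (BCon ar (quot A (cjoin ar A \<theta> (diamond ar A \<phi>)))) \<le> 2))"
proof -
  have pair_in: "in_var ar Sig (pairalg A \<beta>)" if "\<beta> \<in> Con ar A" for \<beta>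
    using pairalg_in_var[OF A_in that] .
  \<comment> \<open>Modularity comes from the pair algebras at type \<open>'a \<times> 'a\<close>;
    the quotients of \<open>A\<close> and of the pair algebras stay in their types because they are
    carried by representatives.\<close>
  interpret semidegenerate_modular ar A
  proof
    show "is_alg ar A" using A_in unfolding in_var_def by simp
    show "K_comm_closed ar A" using V1 A_in unfolding var_hyp_def by blast
    show "con_modular ar (pairalg A \<beta>)" if "\<beta> \<in> Con ar A" for \<beta>
      using V3 pair_in[OF that] unfolding var_hyp_def by blast
    show "\<theta> = Nabla A" if "\<theta> \<in> Con ar A" "x \<in> univ A"
      "\<And>f. (x, ops A f (replicate (ar f) x)) \<in> \<theta>" for \<theta> x
      using quotient_idempotent_trivial[OF V1 A_in that] .
    show "\<Theta> = Nabla (pairalg A \<beta>)" if "\<beta> \<in> Con ar A" "\<Theta> \<in> Con ar (pairalg A \<beta>)" "u \<in> \<beta>"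
      "\<And>f. (u, ops (pairalg A \<beta>) f (replicate (ar f) u)) \<in> \<Theta>" for \<beta> \<Theta> u
      using that(3) by (intro quotient_idempotent_trivial[OF V3 pair_in[OF that(1)] that(2) _ that(4)]) simp
  qed (rule fin_sig)
  define P2 where "P2 \<longleftrightarrow> (\<forall>\<phi>\<in>\<C>. \<forall>\<psi>\<in>\<C>. \<phi> \<squnion> \<psi> = \<nabla> \<and> \<phi> \<odot> \<psi> \<subseteq> \<theta> \<longrightarrow> lifts \<theta> \<phi> \<psi>)"
  define P3 where "P3 \<longleftrightarrow> (\<forall>\<phi>\<in>\<C>. \<forall>\<psi>\<in>\<C>. \<phi> \<squnion> \<psi> = \<nabla> \<and> \<phi> \<odot> \<psi> = \<theta> \<longrightarrow> lifts \<theta> \<phi> \<psi>)"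
  define P4 where "P4 \<longleftrightarrow> (\<forall>\<phi>. maximal_con ar A \<phi> \<longrightarrow>
    finite (BCon ar (quot A (\<theta> \<squnion> diamond ar A \<phi>))) \<and> card (BCon ar (quot A (\<theta> \<squnion> diamond ar A \<phi>))) \<le> 2)"
  have s: "\<theta> \<squnion> diamond ar A \<phi> \<in> \<C>" for \<phi> using theta by auto
  \<comment> \<open>(1), (2) and (3) form a cycle; (4) is tied to (2) in both directions.\<close>
  have 12: "CBLP ar A \<theta> \<Longrightarrow> P2" unfolding P2_def using CBLP_imp_lifts[OF theta] by blast
  have 23: "P2 \<Longrightarrow> P3" unfolding P2_def P3_def by blast
  have 31: "P3 \<Longrightarrow> CBLP ar A \<theta>" unfolding P3_def by (rule lifts_imp_CBLP[OF theta]) blast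
  have 24: "P4" if P2
    unfolding P4_def card_BCon_quot_iff[OF s]
  proof (intro allI impI)
    fix \<phi> \<gamma> \<gamma>' assume "maximal_con ar A \<phi>" "complementary_over (\<theta> \<squnion> diamond ar A \<phi>) \<gamma> \<gamma>'"
    then show "\<gamma> = \<theta> \<squnion> diamond ar A \<phi> \<or> \<gamma> = \<nabla>"
      by (rule lifts_imp_indecomposable[OF theta, rotated]) (use that P2_def in blast)
  qed
  have 42: "P2" if P4
    unfolding P2_def
  proof (intro ballI impI, elim conjE)
    fix \<phi> \<psi> assume "\<phi> \<in> \<C>" "\<psi> \<in> \<C>" "\<phi> \<squnion> \<psi> = \<nabla>" "\<phi> \<odot> \<psi> \<subseteq> \<theta>"
    then show "lifts \<theta> \<phi> \<psi>"
      by (rule indecomposable_imp_lifts[OF theta, rotated])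
        (use that in \<open>unfold P4_def card_BCon_quot_iff[OF s], blast\<close>)
  qed
  have "(CBLP ar A \<theta> \<longleftrightarrow> P2) \<and> (P2 \<longleftrightarrow> P3) \<and> (CBLP ar A \<theta> \<longleftrightarrow> P4)"
    using 12 23 31 24 42 by blast
  then show ?thesis unfolding P2_def P3_def P4_def .
qed

end
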